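(* Let $G_1, G_2$ be disjoint graphs, where $G_i$ has $n_i$ vertices and $m_i$ edges with $m_i \ge n_i$ for $i = 1,2$, such that $2$ is not a signless Laplacian eigenvalue of either $G_1$ or $G_2$. Let $u$ be a vertex of $G_1$ and $v$ a vertex of $G_2$. If $\varphi_{G_1}(u) + \varphi_{G_2}(v) > -1$, then the graph $G = G_1 \cup G_2 + uv$, obtained from the disjoint union of $G_1$ and $G_2$ by adding the edge $uv$, satisfies $$s(L(G)) = s(L(G_1)) + s(L(G_2)) - 1,$$ and $2$ is not a signless Laplacian eigenvalue of $G$.
   Context: All graphs are finite and simple. For a graph $H$ with adjacency matrix $A(H)$, the signature $s(H)$ is the number of positive eigenvalues of $A(H)$ minus the number of negative eigenvalues of $A(H)$, counted with multiplicity. The line graph $L(G)$ has the edges of $G$ as vertices, two being adjacent when they are distinct and share an endpoint. The signless Laplacian of $G$ is $Q(G) = A(G) + D(G)$, where $D(G)$ is the diagonal matrix of vertex degrees; its eigenvalues are the signless Laplacian eigenvalues of $G$. For a graph $G$ such that $2$ is not an eigenvalue of $Q(G)$, and a vertex $x$ of $G$, $\varphi_G(x)$ denotes the $(x,x)$ entry of $(Q(G) - 2I)^{-1}$. *)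

theory Defs
  imports
    "Jordan_Normal_Form.Char_Poly"
    "Jordan_Normal_Form.Gauss_Jordan_Elimination"
    "HOL-Library.Countable_Set"
begin

record 'a ugraph =
  verts :: "'a set"
  edges :: "'a set set"

definition simple_graph :: "'a ugraph \<Rightarrow> bool" where
  "simple_graph G \<longleftrightarrow>
     finite (verts G) \<and> (\<forall>e \<in> edges G. e \<subseteq> verts G \<and> card e = 2)"

definition vertex_degree :: "'a ugraph \<Rightarrow> 'a \<Rightarrow> nat" where
  "vertex_degree G x = card {e \<in> edges G. x \<in> e}"

definition line_graph :: "'a ugraph \<Rightarrow> 'a set ugraph" where
  "line_graph G =
     \<lparr>verts = edges G,
      edges = {{e, f} |e f. e \<in> edges G \<and> f \<in> edges G \<and> e \<noteq> f \<and> e \<inter> f \<noteq> {}}\<rparr>"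

definition graph_union :: "'a ugraph \<Rightarrow> 'a ugraph \<Rightarrow> 'a ugraph" where
  "graph_union G H = \<lparr>verts = verts G \<union> verts H, edges = edges G \<union> edges H\<rparr>"

definition add_edge :: "'a ugraph \<Rightarrow> 'a \<Rightarrow> 'a \<Rightarrow> 'a ugraph" where
  "add_edge G x y = \<lparr>verts = verts G, edges = insert {x, y} (edges G)\<rparr>"

text \<open>
  For a finite set \<open>V\<close>, \<open>from_nat_into V\<close> is a bijection from \<open>{..<card V}\<close> onto \<open>V\<close> with
  inverse \<open>to_nat_on V\<close>. Row and column \<open>i\<close> of the matrices below belong to the vertex
  \<open>from_nat_into V i\<close>. Another enumeration of \<open>V\<close> conjugates the matrices by a permutation
  matrix, so none of the quantities derived from them depends on this choice.
\<close>

definition adjacency_matrix :: "'a ugraph \<Rightarrow> real mat" where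
  "adjacency_matrix G =
     mat (card (verts G)) (card (verts G))
       (\<lambda>(i, j). if {from_nat_into (verts G) i, from_nat_into (verts G) j} \<in> edges G then 1 else 0)"

definition degree_matrix :: "'a ugraph \<Rightarrow> real mat" where
  "degree_matrix G =
     mat (card (verts G)) (card (verts G))
       (\<lambda>(i, j). if i = j then real (vertex_degree G (from_nat_into (verts G) i)) else 0)"

definition signless_laplacian :: "'a ugraph \<Rightarrow> real mat" where
  "signless_laplacian G = adjacency_matrix G + degree_matrix G"

text \<open>
  Eigenvalues are counted with algebraic multiplicity. Only real eigenvalues are counted, which
  for the (symmetric) adjacency matrices are all of them.
\<close>

definition pos_eigenvalue_count :: "real mat \<Rightarrow> nat" where
  "pos_eigenvalue_count A = (\<Sum>x \<in> {x. eigenvalue A x \<and> x > 0}. Polynomial.order x (char_poly A))"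

definition neg_eigenvalue_count :: "real mat \<Rightarrow> nat" where
  "neg_eigenvalue_count A = (\<Sum>x \<in> {x. eigenvalue A x \<and> x < 0}. Polynomial.order x (char_poly A))"

definition graph_signature :: "'a ugraph \<Rightarrow> int" where
  "graph_signature G =
     int (pos_eigenvalue_count (adjacency_matrix G)) - int (neg_eigenvalue_count (adjacency_matrix G))"

text \<open>
  \<open>mat_inverse\<close> returns \<open>None\<close> exactly on singular matrices, so \<open>phi G x\<close> is meaningful
  when 2 is not an eigenvalue of \<open>signless_laplacian G\<close> and \<open>x \<in> verts G\<close>.
\<close>

definition phi :: "'a ugraph \<Rightarrow> 'a \<Rightarrow> real" where
  "phi G x =
     the (mat_inverse (signless_laplacian G - 2 \<cdot>\<^sub>m 1\<^sub>m (card (verts G))))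
       $$ (to_nat_on (verts G) x, to_nat_on (verts G) x)"

end

theory Submission
  imports Defs
begin

text \<open>With the incidence matrix \<open>N\<close> of a graph, \<open>A(L(G)) = N\<^sup>T N - 2 I\<close> and \<open>Q(G) = N N\<^sup>T\<close>. The matrices
  \<open>N\<^sup>T N - 2 I\<close> and \<open>N N\<^sup>T - 2 I\<close> are, up to definite blocks of sizes \<open>n\<close> and \<open>m\<close>, the two Schur
  complements of one symmetric block matrix, so by Sylvester's law of inertia
  \<open>s(L(G)) = sgn(Q(G) - 2 I) + n - m\<close>, where \<open>sgn\<close> is the signature. Adding the edge \<open>uv\<close> turns
  \<open>B = diag(Q(G\<^sub>1) - 2 I, Q(G\<^sub>2) - 2 I)\<close> into \<open>B + w w\<^sup>T\<close> with \<open>w = e\<^sub>u + e\<^sub>v\<close>, and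
  \<open>1 + w\<^sup>T B\<^sup>-\<^sup>1 w = 1 + \<phi>(u) + \<phi>(v) > 0\<close> makes this update preserve the inertia. Hence the
  signature of \<open>Q - 2 I\<close> is additive and stays nondegenerate, while \<open>m = m\<^sub>1 + m\<^sub>2 + 1\<close> accounts for the
  \<open>-1\<close>.\<close>

section \<open>Diagonalization of real symmetric matrices\<close>

text \<open>The fundamental theorem of algebra supplies a complex eigenvector. Its real and
  imaginary parts satisfy a coupled real system; symmetry of \<open>A\<close> forces the imaginary
  part of the eigenvalue to vanish, which decouples the system, so a nonzero part is a real
  eigenvector.\<close>

lemma symmetric_mat_real_eigenvalue:
  fixes A :: "real mat"
  assumes A: "A \<in> carrier_mat n n" and sym: "transpose_mat A = A" and n: "n > 0"
  obtains v k where "v \<in> carrier_vec n" "v \<bullet> v = 1" "A *\<^sub>v v = k \<cdot>\<^sub>v v"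
proof -
  let ?C = "map_mat complex_of_real A"
  have C: "?C \<in> carrier_mat n n" using A by auto
  have "degree (char_poly ?C) \<noteq> 0" using degree_monic_char_poly[OF C] n by simp
  then obtain z where "poly (char_poly ?C) z = 0"
    using fundamental_theorem_of_algebra[of "char_poly ?C"] by (metis constant_degree)
  then obtain x where x: "x \<in> carrier_vec n" "x \<noteq> 0\<^sub>v n" "?C *\<^sub>v x = z \<cdot>\<^sub>v x"
    using eigenvalue_root_char_poly[OF C] A unfolding eigenvalue_def eigenvector_def by auto
  define a where "a = map_vec Re x"
  define b where "b = map_vec Im x"
  have a: "a \<in> carrier_vec n" and b: "b \<in> carrier_vec n" using x by (auto simp: a_def b_def)
  have row: "(\<Sum>j<n. complex_of_real (A $$ (i, j)) * x $ j) = z * x $ i" if "i < n" for i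
    using arg_cong[OF x(3), of "\<lambda>y. y $ i"] that A x(1)
    by (simp add: scalar_prod_def lessThan_atLeast0)
  have Aa: "A *\<^sub>v a = Re z \<cdot>\<^sub>v a - Im z \<cdot>\<^sub>v b"
  proof (rule eq_vecI)
    fix i assume "i < dim_vec (Re z \<cdot>\<^sub>v a - Im z \<cdot>\<^sub>v b)"
    then have i: "i < n" using b by auto
    show "(A *\<^sub>v a) $ i = (Re z \<cdot>\<^sub>v a - Im z \<cdot>\<^sub>v b) $ i"
      using arg_cong[OF row[OF i], of Re] i A x(1)
      by (simp add: a_def b_def scalar_prod_def lessThan_atLeast0)
  qed (use A a b in auto)
  have Ab: "A *\<^sub>v b = Re z \<cdot>\<^sub>v b + Im z \<cdot>\<^sub>v a"
  proof (rule eq_vecI)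
    fix i assume "i < dim_vec (Re z \<cdot>\<^sub>v b + Im z \<cdot>\<^sub>v a)"
    then have i: "i < n" using a by auto
    show "(A *\<^sub>v b) $ i = (Re z \<cdot>\<^sub>v b + Im z \<cdot>\<^sub>v a) $ i"
      using arg_cong[OF row[OF i], of Im] i A x(1)
      by (simp add: a_def b_def scalar_prod_def lessThan_atLeast0)
  qed (use A a b in auto)
  have nn: "v \<bullet> v \<ge> 0" for v :: "real vec" by (simp add: scalar_prod_def sum_nonneg)
  have pos: "v \<bullet> v > 0" if "v \<in> carrier_vec n" "v \<noteq> 0\<^sub>v n" for v :: "real vec"
  proof -
    have "\<not> (\<forall>i<n. v $ i = 0)" using that eq_vecI[of v "0\<^sub>v n"] by auto
    then obtain i where "i < n" "v $ i \<noteq> 0" by blast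
    then have "(\<Sum>i\<in>{0..<n}. v $ i * v $ i) > 0"
      by (intro sum_pos2[of _ i]) (auto simp: zero_less_mult_iff)
    then show ?thesis using that by (simp add: scalar_prod_def)
  qed
  have "a \<noteq> 0\<^sub>v n \<or> b \<noteq> 0\<^sub>v n"
  proof (rule ccontr)
    assume 0: "\<not> ?thesis"
    have "Re (x $ i) = 0" "Im (x $ i) = 0" if "i < n" for i
    proof -
      have "a $ i = 0" "b $ i = 0" using 0 that by simp_all
      then show "Re (x $ i) = 0" "Im (x $ i) = 0" using that x(1) by (simp_all add: a_def b_def)
    qed
    then have "x $ i = 0" if "i < n" for i using that by (simp add: complex_eq_iff)
    then show False using x(1,2) eq_vecI[of x "0\<^sub>v n"] by auto
  qed
  then have ab: "a \<bullet> a + b \<bullet> b > 0" using pos[OF a] pos[OF b] nn[of a] nn[of b] by linarith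
  \<comment> \<open>Symmetry moves \<open>A\<close> to the other factor. Expanding both sides shows
    that \<open>Im z\<close> times the squared norm of the complex eigenvector is zero.\<close>
  have "a \<bullet> (A *\<^sub>v b) = (A *\<^sub>v a) \<bullet> b"
    using transpose_vec_mult_scalar[OF A b a] sym by simp
  then have "Re z * (a \<bullet> b) + Im z * (a \<bullet> a) = Re z * (a \<bullet> b) - Im z * (b \<bullet> b)"
    using a b unfolding Aa Ab
    by (simp add: scalar_prod_add_distrib[of _ n] minus_scalar_prod_distrib[of _ n])
  then have "Im z * (a \<bullet> a + b \<bullet> b) = 0" by (simp add: algebra_simps)
  then have z: "Im z = 0" using ab by simp
  have ev: "A *\<^sub>v a = Re z \<cdot>\<^sub>v a" "A *\<^sub>v b = Re z \<cdot>\<^sub>v b"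
    using a b by (auto simp: Aa Ab z)
  obtain w where w: "w \<in> carrier_vec n" "w \<noteq> 0\<^sub>v n" "A *\<^sub>v w = Re z \<cdot>\<^sub>v w"
    using \<open>a \<noteq> 0\<^sub>v n \<or> b \<noteq> 0\<^sub>v n\<close> a b ev by blast
  define c where "c = 1 / sqrt (w \<bullet> w)"
  show thesis
  proof
    show "c \<cdot>\<^sub>v w \<in> carrier_vec n" using w by simp
    show "(c \<cdot>\<^sub>v w) \<bullet> (c \<cdot>\<^sub>v w) = 1" using pos[OF w(1,2)] by (simp add: c_def)
    show "A *\<^sub>v (c \<cdot>\<^sub>v w) = Re z \<cdot>\<^sub>v (c \<cdot>\<^sub>v w)"
      using w A by (simp add: mult_mat_vec[of _ n n] smult_smult_assoc mult.commute[of c])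
  qed
qed

text \<open>A Householder reflection. If \<open>v\<close> is the first unit vector, the factor \<open>2 / 0 = 0\<close> makes it
  the identity.\<close>

lemma reflection_to_unit_vec:
  fixes v :: "real vec"
  assumes v: "v \<in> carrier_vec n" "v \<bullet> v = 1" and n: "n > 0"
  obtains H where "H \<in> carrier_mat n n" "transpose_mat H = H" "H * H = 1\<^sub>m n"
    "H *\<^sub>v unit_vec n 0 = v"
proof -
  define w where "w = v - unit_vec n 0"
  define s where "s = (\<Sum>i<n. w $ i * w $ i)"
  define c where "c = 2 / s"
  have w: "w \<in> carrier_vec n" using v by (simp add: w_def)
  have wi: "w $ i = v $ i - (if i = 0 then 1 else 0)" if "i < n" for i
    using that v n by (simp add: w_def)
  define H where "H = mat n n (\<lambda>(i, j). (if i = j then 1 else 0) - c * w $ i * w $ j)"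
  have vs: "(\<Sum>i<n. v $ i * v $ i) = 1"
    using v by (simp add: scalar_prod_def lessThan_atLeast0)
  \<comment> \<open>Only the entry of \<open>w\<close> at 0 differs from that of \<open>v\<close>,
    and \<open>v\<close> has norm 1, so \<open>s = 2 - 2 * v $ 0\<close>.\<close>
  have "s = (\<Sum>i<n. v $ i * v $ i + (if i = 0 then 1 - 2 * v $ i else 0))"
    unfolding s_def by (rule sum.cong) (auto simp: wi algebra_simps)
  also have "\<dots> = 1 + (1 - 2 * v $ 0)" using n by (simp add: sum.distrib vs)
  finally have s: "s = - 2 * w $ 0" using n by (simp add: wi)
  have cc: "c * c * s = 2 * c" by (simp add: c_def)
  \<comment> \<open>Entrywise form of \<open>H *\<^sub>v unit_vec n 0 = v\<close>. If
    \<open>s = 0\<close> then \<open>w = 0\<close>; otherwise \<open>s = - 2 * w $ 0\<close> gives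
    \<open>c * w $ 0 = -1\<close>.\<close>
  have col: "w $ i = - c * w $ i * w $ 0" if "i < n" for i
  proof (cases "s = 0")
    case True
    then have "w $ i * w $ i = 0"
      using that unfolding s_def by (subst (asm) sum_nonneg_eq_0_iff) auto
    then show ?thesis by simp
  next
    case False
    then have "c * w $ 0 = -1" using s by (simp add: c_def field_simps)
    moreover have "- c * w $ i * w $ 0 = - (c * w $ 0) * w $ i" by simp
    ultimately show ?thesis by simp
  qed
  show thesis
  proof
    show H: "H \<in> carrier_mat n n" by (simp add: H_def)
    show "transpose_mat H = H" by (rule eq_matI) (auto simp: H_def)
    show "H * H = 1\<^sub>m n"
    proof (rule eq_matI)
      fix i j assume "i < dim_row (1\<^sub>m n)" "j < dim_col (1\<^sub>m n)"
      then have ij: "i < n" "j < n" by auto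
      have "(H * H) $$ (i, j) = (\<Sum>k<n. ((if i = k then 1 else 0) - c * w $ i * w $ k)
          * ((if k = j then 1 else 0) - c * w $ k * w $ j))"
        using ij by (simp add: H_def scalar_prod_def lessThan_atLeast0)
      also have "\<dots> = (\<Sum>k<n. (if k = i then (if k = j then 1 else 0) - c * w $ k * w $ j else 0)
          - (if k = j then c * w $ i * w $ k else 0)
          + c * c * w $ i * w $ j * (w $ k * w $ k))"
        by (rule sum.cong) (auto simp: algebra_simps)
      also have "\<dots> = (if i = j then 1 else 0) - c * w $ i * w $ j - c * w $ i * w $ j
          + c * c * w $ i * w $ j * s"
        using ij by (simp add: sum.distrib sum_subtractf s_def sum_distrib_left)
      also have "\<dots> = (if i = j then 1 else 0) + (c * c * s - 2 * c) * (w $ i * w $ j)"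
        by (simp add: algebra_simps)
      finally show "(H * H) $$ (i, j) = 1\<^sub>m n $$ (i, j)" using ij cc by simp
    qed (auto simp: H_def)
    show "H *\<^sub>v unit_vec n 0 = v"
    proof (rule eq_vecI)
      fix i assume "i < dim_vec v"
      then have i: "i < n" using v by simp
      have "(H *\<^sub>v unit_vec n 0) $ i = (if i = 0 then 1 else 0) - c * w $ i * w $ 0"
        using i n by (simp add: H_def)
      then show "(H *\<^sub>v unit_vec n 0) $ i = v $ i" using col[OF i] wi[OF i] by simp
    qed (use v in \<open>auto simp: H_def\<close>)
  qed
qed

text \<open>Induction on the size. A reflection \<open>H\<close> taking the first unit vector to a
  unit eigenvector splits off a 1 by 1 block from \<open>H * A * H\<close>; the remaining block is
  symmetric and is diagonalized by the induction hypothesis.\<close>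

lemma symmetric_mat_diagonalization:
  fixes A :: "real mat"
  assumes "A \<in> carrier_mat n n" and "transpose_mat A = A"
  shows "\<exists>U d. U \<in> carrier_mat n n \<and> transpose_mat U * U = 1\<^sub>m n
    \<and> transpose_mat U * A * U = mat_diag n d"
  using assms
proof (induction n arbitrary: A)
  case 0
  show ?case
    by (intro exI[of _ "1\<^sub>m 0"] exI[of _ "\<lambda>_. 0"] conjI eq_matI) (use 0 in \<open>auto simp: mat_diag_def\<close>)
next
  case (Suc n)
  note A = Suc.prems(1)
  obtain v k where v: "v \<in> carrier_vec (Suc n)" "v \<bullet> v = 1" "A *\<^sub>v v = k \<cdot>\<^sub>v v"
    using symmetric_mat_real_eigenvalue[OF Suc.prems] by blast
  obtain H where H: "H \<in> carrier_mat (Suc n) (Suc n)" "transpose_mat H = H" "H * H = 1\<^sub>m (Suc n)"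
    "H *\<^sub>v unit_vec (Suc n) 0 = v"
    using reflection_to_unit_vec[OF v(1,2)] by blast
  let ?e = "unit_vec (Suc n) 0 :: real vec"
  define B where "B = H * A * H"
  have B: "B \<in> carrier_mat (Suc n) (Suc n)" using A H by (simp add: B_def)
  have Bsym: "transpose_mat B = B"
    using A H Suc.prems(2) unfolding B_def
    by (simp add: transpose_mult[of _ "Suc n" "Suc n" _ "Suc n"] assoc_mult_mat[of _ "Suc n" "Suc n" _ "Suc n" _ "Suc n"])
  have He: "H *\<^sub>v v = ?e"
    using H by (metis assoc_mult_mat_vec one_mult_mat_vec unit_vec_carrier)
  have "B *\<^sub>v ?e = H *\<^sub>v (A *\<^sub>v (H *\<^sub>v ?e))"
    using A H(1) by (simp add: B_def assoc_mult_mat_vec[of _ "Suc n" "Suc n" _ "Suc n"])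
  also have "\<dots> = k \<cdot>\<^sub>v ?e"
    using H(1) v(1) by (simp add: H(4) v(3) mult_mat_vec[of _ "Suc n" "Suc n"] He)
  finally have Be: "B *\<^sub>v ?e = k \<cdot>\<^sub>v ?e" .
  \<comment> \<open>The eigenvector equation determines the first column of \<open>B\<close>, and
    symmetry then determines the first row.\<close>
  have col0: "B $$ (i, 0) = (if i = 0 then k else 0)" if "i < Suc n" for i
    using arg_cong[OF Be, of "\<lambda>y. y $ i"] that B by simp
  have row0: "B $$ (0, i) = (if i = 0 then k else 0)" if "i < Suc n" for i
    using col0[OF that] that B arg_cong[OF Bsym, of "\<lambda>M. M $$ (0, i)"] by simp
  define C where "C = mat n n (\<lambda>(i, j). B $$ (Suc i, Suc j))"
  have C: "C \<in> carrier_mat n n" by (simp add: C_def)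
  have "transpose_mat C = C"
  proof (rule eq_matI)
    fix i j assume "i < dim_row C" "j < dim_col C"
    then show "transpose_mat C $$ (i, j) = C $$ (i, j)"
      using B arg_cong[OF Bsym, of "\<lambda>M. M $$ (Suc i, Suc j)"] by (simp add: C_def)
  qed (simp_all add: C_def)
  then obtain V d where V: "V \<in> carrier_mat n n" "transpose_mat V * V = 1\<^sub>m n"
    "transpose_mat V * C * V = mat_diag n d"
    using Suc.IH[OF C] by blast
  define K where "K = mat 1 1 (\<lambda>_. k)"
  have K: "K \<in> carrier_mat 1 1" by (simp add: K_def)
  have Bblock: "B = four_block_mat K (0\<^sub>m 1 n) (0\<^sub>m n 1) C"
    using B col0 row0 by (intro eq_matI) (auto simp: K_def C_def)
  define W where "W = four_block_mat (1\<^sub>m 1) (0\<^sub>m 1 n) (0\<^sub>m n 1) V"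
  have W: "W \<in> carrier_mat (Suc n) (Suc n)"
    using four_block_carrier_mat[of "1\<^sub>m 1" 1 1 V n n] V(1) by (simp add: W_def)
  have WT: "transpose_mat W = four_block_mat (1\<^sub>m 1) (0\<^sub>m 1 n) (0\<^sub>m n 1) (transpose_mat V)"
    unfolding W_def using V(1) by (simp add: transpose_four_block_mat[of _ 1 1 _ n _ n])
  have VT: "transpose_mat V \<in> carrier_mat n n" using V(1) by simp
  have WW: "transpose_mat W * W = 1\<^sub>m (Suc n)"
    unfolding WT unfolding W_def using V VT
    by (subst mult_four_block_mat[of _ 1 1 _ n _ n _ _ 1 _ n]) auto
  have "transpose_mat W * B = four_block_mat K (0\<^sub>m 1 n) (0\<^sub>m n 1) (transpose_mat V * C)"
    unfolding WT Bblock using V(1) VT C K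
    by (subst mult_four_block_mat[of _ 1 1 _ n _ n _ _ 1 _ n]) auto
  then have "transpose_mat W * B * W = four_block_mat K (0\<^sub>m 1 n) (0\<^sub>m n 1) (mat_diag n d)"
    unfolding V(3)[symmetric] unfolding W_def using V(1) VT C K
    by (simp add: mult_four_block_mat[of _ 1 1 _ n _ n _ _ 1 _ n])
  also have "\<dots> = mat_diag (Suc n) (\<lambda>i. case i of 0 \<Rightarrow> k | Suc i \<Rightarrow> d i)"
    by (rule eq_matI) (auto simp: K_def mat_diag_def split: nat.split)
  finally have WBW: "transpose_mat W * B * W = mat_diag (Suc n) (\<lambda>i. case i of 0 \<Rightarrow> k | Suc i \<Rightarrow> d i)" .
  note ac = assoc_mult_mat[of _ "Suc n" "Suc n" _ "Suc n" _ "Suc n"]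
  have WTc: "transpose_mat W \<in> carrier_mat (Suc n) (Suc n)" using W by simp
  have UT: "transpose_mat (H * W) = transpose_mat W * H"
    using H W by (simp add: transpose_mult[of _ "Suc n" "Suc n" _ "Suc n"])
  have "transpose_mat (H * W) * (H * W) = transpose_mat W * (H * H) * W"
    unfolding UT using H(1) W WTc by (simp add: ac)
  also have "\<dots> = 1\<^sub>m (Suc n)" using H(3) WW W by simp
  finally have 1: "transpose_mat (H * W) * (H * W) = 1\<^sub>m (Suc n)" .
  have 2: "transpose_mat (H * W) * A * (H * W) = transpose_mat W * B * W"
    unfolding UT B_def using H(1) W WTc A by (simp add: ac)
  show ?case using 1 2 WBW H(1) W by (intro exI[of _ "H * W"]) auto
qed

text \<open>Common generalization of \<open>pos_eigenvalue_count\<close> and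
  \<open>neg_eigenvalue_count\<close>, so that positive and negative eigenvalues can be treated by
  the same lemmas.\<close>

definition eigenvalue_count :: "(real \<Rightarrow> bool) \<Rightarrow> real mat \<Rightarrow> nat" where
  "eigenvalue_count R A = (\<Sum>x \<in> {x. eigenvalue A x \<and> R x}. Polynomial.order x (char_poly A))"

lemma order_prod_linear_factors:
  fixes d :: "'i \<Rightarrow> 'a::idom"
  assumes "finite I"
  shows "Polynomial.order x (\<Prod>i\<in>I. [:- d i, 1:]) = card {i \<in> I. d i = x}"
  using assms
proof induction
  case (insert j I)
  have nz: "(\<Prod>i\<in>insert j I. [:- d i, 1:]) \<noteq> 0" using insert.hyps(1) by (subst prod_zero_iff) auto
  have "Polynomial.order x [:- d j, 1:] = (if d j = x then 1 else 0)"
    using order_power_n_n[of x 1] by (auto intro: order_0I)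
  moreover have "{i \<in> insert j I. d i = x}
      = (if d j = x then insert j {i \<in> I. d i = x} else {i \<in> I. d i = x})" by auto
  moreover have "Polynomial.order x (\<Prod>i\<in>insert j I. [:- d i, 1:])
      = Polynomial.order x [:- d j, 1:] + card {i \<in> I. d i = x}"
    using nz unfolding prod.insert[OF insert.hyps] insert.IH[symmetric] by (rule order_mult)
  ultimately show ?case using insert.hyps by simp
qed simp

text \<open>An orthogonal \<open>U\<close> makes the congruence a similarity, so the characteristic
  polynomial is the product of the factors with roots \<open>d i\<close>. Counting with multiplicity
  becomes counting indices.\<close>

lemma eigenvalue_count_diagonalization:
  assumes A: "A \<in> carrier_mat n n" and U: "U \<in> carrier_mat n n" "transpose_mat U * U = 1\<^sub>m n"
    and D: "transpose_mat U * A * U = mat_diag n d"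
  shows "eigenvalue_count R A = card {i \<in> {..<n}. R (d i)}"
    and "eigenvalue A x \<longleftrightarrow> (\<exists>i<n. d i = x)"
proof -
  have UT: "transpose_mat U \<in> carrier_mat n n" using U by simp
  have UU: "U * transpose_mat U = 1\<^sub>m n" by (rule mat_mult_left_right_inverse[OF UT U])
  have "similar_mat (mat_diag n d) A"
    by (rule similar_matI[of _ _ "transpose_mat U" U n]) (use A U UT UU D in auto)
  then have "char_poly A = char_poly (mat_diag n d)" using char_poly_similar by metis
  also have "\<dots> = (\<Prod>a\<leftarrow>diag_mat (mat_diag n d). [:- a, 1:])"
    by (rule char_poly_upper_triangular[of _ n]) (auto simp: mat_diag_def)
  also have "diag_mat (mat_diag n d) = map d [0..<n]"
    by (auto simp: diag_mat_def mat_diag_def)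
  also have "(\<Prod>a\<leftarrow>map d [0..<n]. [:- a, 1:]) = (\<Prod>i\<in>{..<n}. [:- d i, 1:])"
    using prod.distinct_set_conv_list[of "[0..<n]" "\<lambda>i. [:- d i, 1:]"]
    by (simp add: lessThan_atLeast0 comp_def)
  finally have cp: "char_poly A = (\<Prod>i\<in>{..<n}. [:- d i, 1:])" .
  show ev: "eigenvalue A x \<longleftrightarrow> (\<exists>i<n. d i = x)" for x
    unfolding eigenvalue_root_char_poly[OF A] cp by (auto simp: poly_prod)
  have set: "{x. eigenvalue A x \<and> R x} = d ` {i \<in> {..<n}. R (d i)}" using ev by auto
  \<comment> \<open>The indices are grouped by the value of \<open>d\<close>; the size of a group is
    the multiplicity of that value.\<close>
  have "card {i \<in> {..<n}. R (d i)}
      = (\<Sum>x\<in>d ` {i \<in> {..<n}. R (d i)}. card {i \<in> {i \<in> {..<n}. R (d i)}. d i = x})"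
    using sum.image_gen[of "{i \<in> {..<n}. R (d i)}" "\<lambda>_. 1::nat" d] by simp
  also have "\<dots> = (\<Sum>x\<in>d ` {i \<in> {..<n}. R (d i)}. card {i \<in> {..<n}. d i = x})"
    by (rule sum.cong[OF refl], rule arg_cong[where f = card]) auto
  finally show "eigenvalue_count R A = card {i \<in> {..<n}. R (d i)}"
    unfolding eigenvalue_count_def set cp by (simp add: order_prod_linear_factors)
qed

text \<open>The matrix that diagonalizes \<open>A\<close> also diagonalizes \<open>- A\<close>, with
  negated entries. This carries results on positive eigenvalues over to negative ones.\<close>

lemma eigenvalue_count_uminus:
  assumes A: "A \<in> carrier_mat n n" and sym: "transpose_mat A = A"
  shows "eigenvalue_count R (- A) = eigenvalue_count (\<lambda>x. R (- x)) A"
proof -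
  obtain U d where U: "U \<in> carrier_mat n n" "transpose_mat U * U = 1\<^sub>m n"
    "transpose_mat U * A * U = mat_diag n d"
    using symmetric_mat_diagonalization[OF assms] by blast
  have UT: "transpose_mat U \<in> carrier_mat n n" using U by simp
  have "transpose_mat U * (- A) * U = - (transpose_mat U * A * U)"
    using A U(1) UT by simp
  also have "\<dots> = mat_diag n (\<lambda>i. - d i)" unfolding U(3) by (rule eq_matI) (auto simp: mat_diag_def)
  finally have "eigenvalue_count R (- A) = card {i \<in> {..<n}. R (- d i)}"
    using eigenvalue_count_diagonalization(1)[OF _ U(1,2)] A by simp
  then show ?thesis using eigenvalue_count_diagonalization(1)[OF A U] by simp
qed

section \<open>Positive eigenvalues under congruence\<close>

lemma homogeneous_system_nontrivial_solution:
  fixes F :: "'a::field vec set"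
  assumes "finite F" and F: "F \<subseteq> carrier_vec m" and "card F < m"
  obtains y where "y \<in> carrier_vec m" "y \<noteq> 0\<^sub>v m" "\<forall>r\<in>F. r \<bullet> y = 0"
proof -
  obtain xs where xs: "set xs = F" "distinct xs" using finite_distinct_list[OF \<open>finite F\<close>] by blast
  then have len: "length xs < m" using \<open>card F < m\<close> distinct_card by fastforce
  define c where "c i = (if i < length xs then xs ! i else 0\<^sub>v m)" for i
  \<comment> \<open>Padding with zero rows makes the system square. The row \<open>length xs\<close>
    exists because \<open>length xs < m\<close>, and being zero it annihilates the
    determinant.\<close>
  define M where "M = mat\<^sub>r m m (\<lambda>i. if i = length xs then 0\<^sub>v m else c i)"
  have c: "c i \<in> carrier_vec m" for i using xs F by (auto simp: c_def)
  have M: "M \<in> carrier_mat m m" by (simp add: M_def)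
  have "det M = 0" unfolding M_def by (rule det_row_0[OF len]) (use c in auto)
  then obtain y where y: "y \<in> carrier_vec m" "y \<noteq> 0\<^sub>v m" "M *\<^sub>v y = 0\<^sub>v m"
    using det_0_iff_vec_prod_zero[OF M] by blast
  have "r \<bullet> y = 0" if "r \<in> F" for r
  proof -
    have "r \<in> set xs" using that xs by simp
    then obtain i where i: "i < length xs" "xs ! i = r" unfolding in_set_conv_nth by blast
    have "row M i = r" using i len c[of i] by (simp add: M_def c_def)
    then show ?thesis using arg_cong[OF y(3), of "\<lambda>y. y $ i"] i len M by simp
  qed
  then show thesis using that y by blast
qed

lemma quadratic_form_mat_diag:
  fixes x :: "real vec"
  assumes "x \<in> carrier_vec n"
  shows "(mat_diag n d *\<^sub>v x) \<bullet> x = (\<Sum>i<n. d i * (x $ i)\<^sup>2)"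
proof -
  have "(mat_diag n d *\<^sub>v x) $ i = d i * x $ i" if "i < n" for i
  proof -
    have "(mat_diag n d *\<^sub>v x) $ i = (\<Sum>j<n. (if i = j then d j else 0) * x $ j)"
      using that assms by (simp add: mat_diag_def scalar_prod_def lessThan_atLeast0)
    also have "\<dots> = (\<Sum>j<n. if j = i then d j * x $ j else 0)" by (rule sum.cong) auto
    finally show ?thesis using that by simp
  qed
  then show ?thesis
    using assms by (auto simp: scalar_prod_def lessThan_atLeast0 power2_eq_square intro!: sum.cong)
qed

text \<open>If the left side were larger, then by counting equations some nonzero vector would be supported
  on positive directions of \<open>S\<^sup>T A S\<close> while its image under \<open>S\<close> avoids those of \<open>A\<close>.\<close>

lemma pos_eigenvalue_count_congruence_le:
  assumes A: "A \<in> carrier_mat n n" "transpose_mat A = A" and S: "S \<in> carrier_mat n m"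
  shows "eigenvalue_count (\<lambda>x. x > 0) (transpose_mat S * A * S) \<le> eigenvalue_count (\<lambda>x. x > 0) A"
proof (rule ccontr)
  assume neg: "\<not> ?thesis"
  let ?B = "transpose_mat S * A * S"
  have ST: "transpose_mat S \<in> carrier_mat m n" using S by simp
  have B: "?B \<in> carrier_mat m m" using A S ST by simp
  have "transpose_mat ?B = ?B"
    using A S ST by (simp add: transpose_mult[of _ m n _ m] transpose_mult[of _ n n _ m]
        assoc_mult_mat[of _ m n _ n _ m])
  then obtain V e where V: "V \<in> carrier_mat m m" "transpose_mat V * V = 1\<^sub>m m"
    "transpose_mat V * ?B * V = mat_diag m e"
    using symmetric_mat_diagonalization[OF B] by blast
  obtain U d where U: "U \<in> carrier_mat n n" "transpose_mat U * U = 1\<^sub>m n"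
    "transpose_mat U * A * U = mat_diag n d"
    using symmetric_mat_diagonalization[OF A] by blast
  have UT: "transpose_mat U \<in> carrier_mat n n" and VT: "transpose_mat V \<in> carrier_mat m m"
    using U V by auto
  have UU: "U * transpose_mat U = 1\<^sub>m n" by (rule mat_mult_left_right_inverse[OF UT U(1,2)])
  \<comment> \<open>\<open>T\<close> is \<open>S\<close> written in the orthonormal eigenbases of
    \<open>A\<close> and of \<open>transpose_mat S * A * S\<close>; it reduces the congruence to one
    between diagonal matrices.\<close>
  define T where "T = transpose_mat U * (S * V)"
  have SV: "S * V \<in> carrier_mat n m" using S V by simp
  have T: "T \<in> carrier_mat n m" using UT SV by (simp add: T_def)
  have UTeq: "U * T = S * V"
    using assoc_mult_mat[OF U(1) UT SV] left_mult_one_mat[OF SV] by (simp add: T_def UU)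
  have TT: "transpose_mat T \<in> carrier_mat m n" using T by simp
  have "transpose_mat T * mat_diag n d * T = transpose_mat T * (transpose_mat U * (A * (U * T)))"
    unfolding U(3)[symmetric] using TT T U(1) UT A
    by (simp add: assoc_mult_mat[of _ m n _ n _ m] assoc_mult_mat[of _ n n _ n _ m]
        assoc_mult_mat[of _ n n _ n _ n])
  also have "\<dots> = transpose_mat (U * T) * (A * (U * T))"
    using TT T U(1) UT A by (simp add: transpose_mult[of _ n n _ m] assoc_mult_mat[of _ m n _ n _ m])
  also have "\<dots> = transpose_mat V * ?B * V"
    unfolding UTeq using S V(1) ST VT A
    by (simp add: transpose_mult[of _ n m _ m] assoc_mult_mat[of _ m n _ n _ m]
        assoc_mult_mat[of _ n n _ m _ m] assoc_mult_mat[of _ m m _ n _ m] assoc_mult_mat[of _ m n _ m _ m]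
        assoc_mult_mat[of _ m m _ m _ m])
  finally have TDT: "transpose_mat T * mat_diag n d * T = mat_diag m e" using V(3) by simp
  \<comment> \<open>The equations ask that \<open>y\<close> vanish where \<open>e\<close> is not
    positive and that \<open>T *\<^sub>v y\<close> vanish where \<open>d\<close> is positive. By the
    assumed strict inequality they are fewer than the \<open>m\<close> unknowns.\<close>
  define F where "F = unit_vec m ` {i \<in> {..<m}. \<not> e i > 0} \<union> row T ` {i \<in> {..<n}. d i > 0}"
  have "card {i \<in> {..<m}. \<not> e i > 0} + card {i \<in> {..<m}. e i > 0} = m"
    using card_Un_disjoint[of "{i \<in> {..<m}. \<not> e i > 0}" "{i \<in> {..<m}. e i > 0}"]
    by (auto simp: Int_def Un_def conj_disj_distribL[symmetric] simp del: not_less)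
  moreover have "card {i \<in> {..<n}. d i > 0} < card {i \<in> {..<m}. e i > 0}"
    using neg eigenvalue_count_diagonalization(1)[OF A(1) U] eigenvalue_count_diagonalization(1)[OF B V]
    by simp
  moreover have "card F \<le> card {i \<in> {..<m}. \<not> e i > 0} + card {i \<in> {..<n}. d i > 0}"
    unfolding F_def by (intro order.trans[OF card_Un_le] add_mono card_image_le) auto
  ultimately have "card F < m" by linarith
  moreover have "finite F" "F \<subseteq> carrier_vec m" using T by (auto simp: F_def)
  ultimately obtain y where y: "y \<in> carrier_vec m" "y \<noteq> 0\<^sub>v m" "\<forall>r\<in>F. r \<bullet> y = 0"
    using homogeneous_system_nontrivial_solution by metis
  define z where "z = T *\<^sub>v y"
  have z: "z \<in> carrier_vec n" using T y by (simp add: z_def)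
  have y0: "y $ i = 0" if "i < m" "\<not> e i > 0" for i
  proof -
    have "unit_vec m i \<in> F" using that by (auto simp: F_def)
    then show ?thesis using y(1,3) that scalar_prod_left_unit[of y m i] by auto
  qed
  have z0: "z $ i = 0" if "i < n" "d i > 0" for i
  proof -
    have "row T i \<in> F" using that by (auto simp: F_def)
    then show ?thesis using y(3) that T by (simp add: z_def)
  qed
  have Dz: "mat_diag n d *\<^sub>v z \<in> carrier_vec n" using z by (rule mult_mat_vec_carrier[OF mat_diag_dim])
  have "mat_diag m e *\<^sub>v y = transpose_mat T *\<^sub>v (mat_diag n d *\<^sub>v z)"
    unfolding TDT[symmetric] z_def using TT T y(1)
    by (simp add: assoc_mult_mat_vec[of _ m n _ m] assoc_mult_mat_vec[of _ m n _ n] mat_diag_dim)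
  then have "(mat_diag m e *\<^sub>v y) \<bullet> y = (mat_diag n d *\<^sub>v z) \<bullet> z"
    using transpose_vec_mult_scalar[OF T y(1) Dz] by (simp add: z_def)
  \<comment> \<open>One value of the quadratic form, computed in both bases: the support of
    \<open>y\<close> makes the left side positive, that of \<open>z\<close> makes the right side at
    most 0.\<close>
  then have eq: "(\<Sum>i<m. e i * (y $ i)\<^sup>2) = (\<Sum>i<n. d i * (z $ i)\<^sup>2)"
    using quadratic_form_mat_diag y(1) z by simp
  have "(\<Sum>i<n. d i * (z $ i)\<^sup>2) \<le> 0"
  proof (rule sum_nonpos)
    fix i assume "i \<in> {..<n}"
    then show "d i * (z $ i)\<^sup>2 \<le> 0"
      using z0[of i] by (cases "d i > 0") (auto simp: mult_nonpos_nonneg)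
  qed
  moreover have "\<not> (\<forall>i<m. y $ i = 0)" using y eq_vecI[of y "0\<^sub>v m"] by auto
  then obtain i where i: "i < m" "y $ i \<noteq> 0" by blast
  then have "e i > 0" using y0 by blast
  have "(\<Sum>i<m. e i * (y $ i)\<^sup>2) > 0"
  proof (rule sum_pos2[of _ i])
    show "0 < e i * (y $ i)\<^sup>2" using i \<open>e i > 0\<close> by simp
    fix j assume "j \<in> {..<m}"
    then show "0 \<le> e j * (y $ j)\<^sup>2" using y0[of j] by (cases "e j > 0") auto
  qed (use i in auto)
  ultimately show False using eq by simp
qed

section \<open>Inertia\<close>

text \<open>The sign \<open>s\<close> lets one statement cover both positive and negative eigenvalues.\<close>

lemma eigenvalue_count_congruence_le:
  assumes s: "s = 1 \<or> s = -1"
    and A: "A \<in> carrier_mat n n" "transpose_mat A = A" and S: "S \<in> carrier_mat n m"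
  shows "eigenvalue_count (\<lambda>x. s * x > 0) (transpose_mat S * A * S)
    \<le> eigenvalue_count (\<lambda>x. s * x > 0) A"
  using s
proof
  assume "s = 1"
  then show ?thesis using pos_eigenvalue_count_congruence_le[OF A S] by simp
next
  assume s: "s = -1"
  have ST: "transpose_mat S \<in> carrier_mat m n" using S by simp
  have B: "transpose_mat S * A * S \<in> carrier_mat m m" using A S ST by simp
  have Bsym: "transpose_mat (transpose_mat S * A * S) = transpose_mat S * A * S"
    using A S ST by (simp add: transpose_mult[of _ m n _ m] transpose_mult[of _ n n _ m]
        assoc_mult_mat[of _ m n _ n _ m])
  \<comment> \<open>Negation exchanges positive and negative eigenvalues, so the positive case is
    applied to \<open>- A\<close>.\<close>
  have "transpose_mat (- A) = - A" using A by (simp add: transpose_uminus)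
  then have "eigenvalue_count (\<lambda>x. x > 0) (transpose_mat S * (- A) * S)
      \<le> eigenvalue_count (\<lambda>x. x > 0) (- A)"
    using pos_eigenvalue_count_congruence_le[of "- A" n S m] A S by simp
  moreover have "transpose_mat S * (- A) * S = - (transpose_mat S * A * S)"
    using A S ST by simp
  ultimately show ?thesis
    using eigenvalue_count_uminus[OF A] eigenvalue_count_uminus[OF B Bsym] s by simp
qed

text \<open>A congruence cannot increase the count, and the congruence by \<open>T\<close> undoes
  the one by \<open>S\<close>, so the count cannot decrease either.\<close>

theorem sylvester_law_of_inertia:
  assumes s: "s = 1 \<or> s = -1"
    and A: "A \<in> carrier_mat n n" "transpose_mat A = A"
    and S: "S \<in> carrier_mat n n" and T: "T \<in> carrier_mat n n" and ST: "S * T = 1\<^sub>m n"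
  shows "eigenvalue_count (\<lambda>x. s * x > 0) (transpose_mat S * A * S)
    = eigenvalue_count (\<lambda>x. s * x > 0) A"
proof (rule antisym)
  show "eigenvalue_count (\<lambda>x. s * x > 0) (transpose_mat S * A * S)
      \<le> eigenvalue_count (\<lambda>x. s * x > 0) A"
    by (rule eigenvalue_count_congruence_le[OF s A S])
  let ?B = "transpose_mat S * A * S"
  have tr: "transpose_mat S \<in> carrier_mat n n" "transpose_mat T \<in> carrier_mat n n"
    using S T by auto
  have B: "?B \<in> carrier_mat n n" using A S by simp
  note ac = assoc_mult_mat[of _ n n _ n _ n]
  have Bsym: "transpose_mat ?B = ?B"
    using A S by (simp add: transpose_mult[of _ n n _ n] ac)
  have "transpose_mat T * ?B * T = transpose_mat T * transpose_mat S * A * (S * T)"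
    using A S T tr by (simp add: ac)
  also have "\<dots> = transpose_mat (S * T) * A * (S * T)"
    using S T by (simp add: transpose_mult[of _ n n _ n])
  also have "\<dots> = A" using A by (simp add: ST)
  finally show "eigenvalue_count (\<lambda>x. s * x > 0) A \<le> eigenvalue_count (\<lambda>x. s * x > 0) ?B"
    using eigenvalue_count_congruence_le[OF s B Bsym T] by simp
qed

text \<open>Orthogonal diagonalizations of the two blocks combine into one of the whole matrix,
  whose diagonal lists \<open>d\<close> and then \<open>e\<close>.\<close>

lemma eigenvalue_count_four_block_diag:
  assumes A: "A \<in> carrier_mat n n" "transpose_mat A = A"
    and D: "D \<in> carrier_mat m m" "transpose_mat D = D"
  shows "eigenvalue_count R (four_block_mat A (0\<^sub>m n m) (0\<^sub>m m n) D)
    = eigenvalue_count R A + eigenvalue_count R D"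
proof -
  obtain U d where U: "U \<in> carrier_mat n n" "transpose_mat U * U = 1\<^sub>m n"
    "transpose_mat U * A * U = mat_diag n d"
    using symmetric_mat_diagonalization[OF A] by blast
  obtain V e where V: "V \<in> carrier_mat m m" "transpose_mat V * V = 1\<^sub>m m"
    "transpose_mat V * D * V = mat_diag m e"
    using symmetric_mat_diagonalization[OF D] by blast
  let ?M = "four_block_mat A (0\<^sub>m n m) (0\<^sub>m m n) D"
  let ?W = "four_block_mat U (0\<^sub>m n m) (0\<^sub>m m n) V"
  let ?f = "\<lambda>i. if i < n then d i else e (i - n)"
  have tr: "transpose_mat U \<in> carrier_mat n n" "transpose_mat V \<in> carrier_mat m m"
    using U V by auto
  have M: "?M \<in> carrier_mat (n + m) (n + m)" and W: "?W \<in> carrier_mat (n + m) (n + m)"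
    using A D U V by simp_all
  have WT: "transpose_mat ?W = four_block_mat (transpose_mat U) (0\<^sub>m n m) (0\<^sub>m m n) (transpose_mat V)"
    using U(1) V(1) by (simp add: transpose_four_block_mat[of _ n n _ m _ m])
  have WW: "transpose_mat ?W * ?W = 1\<^sub>m (n + m)"
    unfolding WT using U V tr by (simp add: mult_four_block_mat[of _ n n _ m _ m _ _ n _ m])
  have "transpose_mat ?W * ?M = four_block_mat (transpose_mat U * A) (0\<^sub>m n m) (0\<^sub>m m n) (transpose_mat V * D)"
    unfolding WT using U(1) V(1) tr A(1) D(1)
    by (simp add: mult_four_block_mat[of _ n n _ m _ m _ _ n _ m])
  then have "transpose_mat ?W * ?M * ?W = four_block_mat (mat_diag n d) (0\<^sub>m n m) (0\<^sub>m m n) (mat_diag m e)"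
    unfolding U(3)[symmetric] V(3)[symmetric] using U(1) V(1) tr A(1) D(1)
    by (simp add: mult_four_block_mat[of _ n n _ m _ m _ _ n _ m])
  also have "\<dots> = mat_diag (n + m) ?f"
    by (rule eq_matI) (auto simp: mat_diag_def)
  finally have "eigenvalue_count R ?M = card {i \<in> {..<n + m}. R (?f i)}"
    using eigenvalue_count_diagonalization(1)[OF M W WW] by simp
  also have "{i \<in> {..<n + m}. R (?f i)} = {i \<in> {..<n}. R (d i)} \<union> (+) n ` {i \<in> {..<m}. R (e i)}"
  proof (intro equalityI subsetI)
    fix i assume "i \<in> {i \<in> {..<n + m}. R (?f i)}"
    then show "i \<in> {i \<in> {..<n}. R (d i)} \<union> (+) n ` {i \<in> {..<m}. R (e i)}"
      by (cases "i < n") (auto intro!: image_eqI[of _ _ "i - n"])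
  qed auto
  also have "card \<dots> = card {i \<in> {..<n}. R (d i)} + card {i \<in> {..<m}. R (e i)}"
    by (subst card_Un_disjoint) (auto simp: card_image)
  finally show ?thesis
    using eigenvalue_count_diagonalization(1)[OF A(1) U] eigenvalue_count_diagonalization(1)[OF D(1) V]
    by simp
qed

lemma eigenvalue_count_smult_one:
  "eigenvalue_count R (c \<cdot>\<^sub>m 1\<^sub>m n) = (if R c then n else 0)"
proof -
  have "transpose_mat (1\<^sub>m n) * (c \<cdot>\<^sub>m 1\<^sub>m n) * 1\<^sub>m n = mat_diag n (\<lambda>_. c)"
    by (simp, rule eq_matI) (auto simp: mat_diag_def)
  from eigenvalue_count_diagonalization(1)[OF _ _ _ this] show ?thesis by simp
qed

text \<open>The two counts together miss exactly the zero entries of a diagonalization. Thus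
  invertibility can be read off from the inertia.\<close>

lemma eigenvalue_count_pos_neg_eq_dim_iff:
  assumes A: "A \<in> carrier_mat n n" "transpose_mat A = A"
  shows "eigenvalue_count (\<lambda>x. x > 0) A + eigenvalue_count (\<lambda>x. x < 0) A = n
    \<longleftrightarrow> \<not> eigenvalue A 0"
proof -
  obtain U d where U: "U \<in> carrier_mat n n" "transpose_mat U * U = 1\<^sub>m n"
    "transpose_mat U * A * U = mat_diag n d"
    using symmetric_mat_diagonalization[OF A] by blast
  note c = eigenvalue_count_diagonalization[OF A(1) U]
  have "eigenvalue_count (\<lambda>x. x > 0) A + eigenvalue_count (\<lambda>x. x < 0) A
      = card ({i \<in> {..<n}. d i > 0} \<union> {i \<in> {..<n}. d i < 0})"
    unfolding c(1) by (rule card_Un_disjoint[symmetric]) auto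
  also have "{i \<in> {..<n}. d i > 0} \<union> {i \<in> {..<n}. d i < 0} = {..<n} - {i \<in> {..<n}. d i = 0}"
    by auto
  also have "card \<dots> = n - card {i \<in> {..<n}. d i = 0}" by (subst card_Diff_subset) auto
  also have "\<dots> = n \<longleftrightarrow> card {i \<in> {..<n}. d i = 0} = 0"
  proof -
    have "card {i \<in> {..<n}. d i = 0} \<le> card {..<n}" by (rule card_mono) auto
    then have "card {i \<in> {..<n}. d i = 0} \<le> n" by simp
    then show ?thesis by linarith
  qed
  also have "\<dots> \<longleftrightarrow> \<not> eigenvalue A 0" unfolding c(2) by auto
  finally show ?thesis .
qed

text \<open>Both sides count the eigenvalues of the block matrix with diagonal blocks \<open>A\<close>, \<open>D\<close> and
  off-diagonal block \<open>A X = (D Y)\<^sup>T\<close>: either diagonal block can be used to eliminate the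
  off-diagonal blocks by a congruence.\<close>

lemma eigenvalue_count_schur_complements:
  fixes A D :: "real mat"
  assumes s: "s = 1 \<or> s = -1"
    and A: "A \<in> carrier_mat n n" "transpose_mat A = A"
    and D: "D \<in> carrier_mat m m" "transpose_mat D = D"
    and X: "X \<in> carrier_mat n m" and Y: "Y \<in> carrier_mat m n"
    and XY: "A * X = transpose_mat (D * Y)"
  shows "eigenvalue_count (\<lambda>x. s * x > 0) A
      + eigenvalue_count (\<lambda>x. s * x > 0) (D - D * Y * X)
    = eigenvalue_count (\<lambda>x. s * x > 0) (A - A * X * Y)
      + eigenvalue_count (\<lambda>x. s * x > 0) D"
proof -
  let ?M = "four_block_mat A (A * X) (D * Y) D"
  have zero: "- 0\<^sub>m m m + 1\<^sub>m m = (1\<^sub>m m :: real mat)"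
    "1\<^sub>m n + - 0\<^sub>m n n = (1\<^sub>m n :: real mat)" "Y + - Y = 0\<^sub>m m n"
    using Y by (auto intro!: eq_matI)
  have XT: "transpose_mat X \<in> carrier_mat m n" and YT: "transpose_mat Y \<in> carrier_mat n m"
    using X Y by auto
  \<comment> \<open>These two forms of \<open>XY\<close> identify the off-diagonal blocks that the
    eliminations with \<open>X\<close> and with \<open>Y\<close> produce.\<close>
  have DY: "D * Y = transpose_mat X * A"
    using arg_cong[OF XY, of transpose_mat] A X by (simp add: transpose_mult[of _ n n _ m])
  have AX: "A * X = transpose_mat Y * D"
    using XY D Y by (simp add: transpose_mult[of _ m m _ n])
  have S1: "D - D * Y * X \<in> carrier_mat m m" "A - A * X * Y \<in> carrier_mat n n"
    using A D X Y by auto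
  have "transpose_mat (D * Y * X) = D * Y * X"
    using A D X Y XT YT unfolding DY
    by (simp add: transpose_mult[of _ m n _ m] transpose_mult[of _ m n _ n] transpose_mult[of _ n n _ m]
        assoc_mult_mat[of _ m n _ n _ m])
  then have S1sym: "transpose_mat (D - D * Y * X) = D - D * Y * X"
    using D X Y by (simp add: transpose_minus[of _ m m])
  have "transpose_mat (A * X * Y) = A * X * Y"
    using A D X Y XT YT unfolding AX
    by (simp add: transpose_mult[of _ n m _ n] transpose_mult[of _ n m _ m] transpose_mult[of _ m m _ n]
        assoc_mult_mat[of _ n m _ m _ n])
  then have S2sym: "transpose_mat (A - A * X * Y) = A - A * X * Y"
    using A X Y by (simp add: transpose_minus[of _ n n])
  have "eigenvalue_count (\<lambda>x. s * x > 0) ?M = eigenvalue_count (\<lambda>x. s * x > 0) A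
      + eigenvalue_count (\<lambda>x. s * x > 0) (D - D * Y * X)"
  proof -
    \<comment> \<open>Elimination with \<open>A\<close> as pivot: the unitriangular congruence by
      \<open>?L\<close> restores the off-diagonal blocks and adds \<open>D * Y * X\<close> to the
      lower right block.\<close>
    let ?E = "four_block_mat A (0\<^sub>m n m) (0\<^sub>m m n) (D - D * Y * X)"
    let ?L = "four_block_mat (1\<^sub>m n) X (0\<^sub>m m n) (1\<^sub>m m)"
    let ?L' = "four_block_mat (1\<^sub>m n) (- X) (0\<^sub>m m n) (1\<^sub>m m)"
    have E: "?E \<in> carrier_mat (n + m) (n + m)" "transpose_mat ?E = ?E"
      using A S1 S1sym by (simp_all add: transpose_four_block_mat[of _ n n _ m _ m])
    have L: "?L \<in> carrier_mat (n + m) (n + m)" "?L' \<in> carrier_mat (n + m) (n + m)" by simp_all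
    have LL: "?L * ?L' = 1\<^sub>m (n + m)"
      using X zero by (simp add: mult_four_block_mat[of _ n n _ m _ m _ _ n _ m])
    have LT: "transpose_mat ?L = four_block_mat (1\<^sub>m n) (0\<^sub>m n m) (transpose_mat X) (1\<^sub>m m)"
      using X by (simp add: transpose_four_block_mat[of _ n n _ m _ m])
    have 1: "transpose_mat ?L * ?E = four_block_mat A (0\<^sub>m n m) (D * Y) (D - D * Y * X)"
      unfolding LT using A X XT S1 DY D Y
      by (simp add: mult_four_block_mat[of _ n n _ m _ m _ _ n _ m])
    have 2: "D * Y * X + (D - D * Y * X) = D"
      using D X Y by (intro eq_matI) auto
    have "transpose_mat ?L * ?E * ?L = ?M"
      unfolding 1 using A X S1 D Y 2
      by (simp add: mult_four_block_mat[of _ n n _ m _ m _ _ n _ m])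
    then show ?thesis
      using sylvester_law_of_inertia[OF s E L LL] eigenvalue_count_four_block_diag[OF A S1(1) S1sym]
      by simp
  qed
  moreover have "eigenvalue_count (\<lambda>x. s * x > 0) ?M
      = eigenvalue_count (\<lambda>x. s * x > 0) (A - A * X * Y) + eigenvalue_count (\<lambda>x. s * x > 0) D"
  proof -
    \<comment> \<open>Elimination with \<open>D\<close> as pivot: this time \<open>A * X * Y\<close>
      is added to the upper left block.\<close>
    let ?E = "four_block_mat (A - A * X * Y) (0\<^sub>m n m) (0\<^sub>m m n) D"
    let ?L = "four_block_mat (1\<^sub>m n) (0\<^sub>m n m) Y (1\<^sub>m m)"
    let ?L' = "four_block_mat (1\<^sub>m n) (0\<^sub>m n m) (- Y) (1\<^sub>m m)"
    have E: "?E \<in> carrier_mat (n + m) (n + m)" "transpose_mat ?E = ?E"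
      using D S1 S2sym by (simp_all add: transpose_four_block_mat[of _ n n _ m _ m])
    have L: "?L \<in> carrier_mat (n + m) (n + m)" "?L' \<in> carrier_mat (n + m) (n + m)" by simp_all
    have LL: "?L * ?L' = 1\<^sub>m (n + m)"
      using Y zero by (simp add: mult_four_block_mat[of _ n n _ m _ m _ _ n _ m])
    have LT: "transpose_mat ?L = four_block_mat (1\<^sub>m n) (transpose_mat Y) (0\<^sub>m m n) (1\<^sub>m m)"
      using Y by (simp add: transpose_four_block_mat[of _ n n _ m _ m])
    have 1: "transpose_mat ?L * ?E = four_block_mat (A - A * X * Y) (A * X) (0\<^sub>m m n) D"
      unfolding LT using A X YT S1 AX D Y
      by (simp add: mult_four_block_mat[of _ n n _ m _ m _ _ n _ m])
    have 2: "A - A * X * Y + A * X * Y = A"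
      using A X Y by (intro eq_matI) auto
    have "transpose_mat ?L * ?E * ?L = ?M"
      unfolding 1 using A X S1 D Y 2
      by (simp add: mult_four_block_mat[of _ n n _ m _ m _ _ n _ m])
    then show ?thesis
      using sylvester_law_of_inertia[OF s E L LL] eigenvalue_count_four_block_diag[OF S1(2) S2sym D]
      by simp
  qed
  ultimately show ?thesis by simp
qed

text \<open>Two enumerations give matrices that are congruent by a permutation matrix. This permits
  replacing \<open>from_nat_into\<close> by an order adapted to a union of vertex sets.\<close>

lemma eigenvalue_count_reindex:
  fixes f :: "'i \<Rightarrow> 'i \<Rightarrow> real"
  assumes s: "s = 1 \<or> s = -1" and f: "\<And>x y. f x y = f y x"
    and e: "bij_betw e {..<n} V" and e': "bij_betw e' {..<n} V"
  shows "eigenvalue_count (\<lambda>x. s * x > 0) (mat n n (\<lambda>(i, j). f (e i) (e j)))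
    = eigenvalue_count (\<lambda>x. s * x > 0) (mat n n (\<lambda>(i, j). f (e' i) (e' j)))"
proof -
  have le: "eigenvalue_count (\<lambda>x. s * x > 0) (mat n n (\<lambda>(i, j). f (g i) (g j)))
      \<le> eigenvalue_count (\<lambda>x. s * x > 0) (mat n n (\<lambda>(i, j). f (h i) (h j)))"
    if g: "bij_betw g {..<n} V" and h: "bij_betw h {..<n} V" for g h
  proof -
    \<comment> \<open>\<open>\<sigma> j\<close> is the position under \<open>h\<close> of the point
      that \<open>g\<close> has at \<open>j\<close>. Column \<open>j\<close> of the permutation
      matrix \<open>S\<close> has its 1 in row \<open>\<sigma> j\<close>.\<close>
    define \<sigma> where "\<sigma> j = inv_into {..<n} h (g j)" for j
    have \<sigma>: "\<sigma> j < n \<and> h (\<sigma> j) = g j" if "j < n" for j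
    proof -
      have "g j \<in> h ` {..<n}" using g h that by (auto simp: bij_betw_def)
      then show ?thesis
        unfolding \<sigma>_def using inv_into_into[of "g j" h "{..<n}"] f_inv_into_f[of "g j" h "{..<n}"] by auto
    qed
    define F where "F = mat n n (\<lambda>(i, j). f (h i) (h j))"
    define S where "S = mat n n (\<lambda>(i, j). if i = \<sigma> j then 1 else 0 :: real)"
    have F: "F \<in> carrier_mat n n" "transpose_mat F = F" and S: "S \<in> carrier_mat n n"
      using f by (auto simp: F_def S_def)
    have FS: "(F * S) $$ (k, j) = F $$ (k, \<sigma> j)" if "k < n" "j < n" for k j
    proof -
      have "(F * S) $$ (k, j) = (\<Sum>l<n. F $$ (k, l) * (if l = \<sigma> j then 1 else 0))"
        using that F by (simp add: S_def scalar_prod_def lessThan_atLeast0)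
      also have "\<dots> = (\<Sum>l<n. if l = \<sigma> j then F $$ (k, l) else 0)" by (rule sum.cong) auto
      finally show ?thesis using \<sigma>[OF that(2)] by simp
    qed
    have "transpose_mat S * F * S = transpose_mat S * (F * S)"
      using F S by (simp add: assoc_mult_mat[of _ n n _ n _ n])
    also have "\<dots> = mat n n (\<lambda>(i, j). f (g i) (g j))"
    proof (rule eq_matI)
      fix i j assume "i < dim_row (mat n n (\<lambda>(i, j). f (g i) (g j)))"
        "j < dim_col (mat n n (\<lambda>(i, j). f (g i) (g j)))"
      then have ij: "i < n" "j < n" by auto
      have "(transpose_mat S * G) $$ (i, j) = (\<Sum>k<n. (if k = \<sigma> i then 1 else 0) * G $$ (k, j))"
        if "G \<in> carrier_mat n n" for G
        using that ij by (simp add: scalar_prod_def lessThan_atLeast0 S_def)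
      then have "(transpose_mat S * (F * S)) $$ (i, j)
          = (\<Sum>k<n. (if k = \<sigma> i then 1 else 0) * (F * S) $$ (k, j))"
        using F S by simp
      also have "\<dots> = (\<Sum>k<n. if k = \<sigma> i then F $$ (k, \<sigma> j) else 0)"
        by (rule sum.cong) (use FS ij in auto)
      finally show "(transpose_mat S * (F * S)) $$ (i, j) = mat n n (\<lambda>(i, j). f (g i) (g j)) $$ (i, j)"
        using \<sigma>[OF ij(1)] \<sigma>[OF ij(2)] ij by (simp add: F_def)
    qed (use S in auto)
    finally show ?thesis
      using eigenvalue_count_congruence_le[OF s F S] by (simp add: F_def)
  qed
  show ?thesis using le[OF e e'] le[OF e' e] by simp
qed

section \<open>Incidence matrices and line graphs\<close>

text \<open>The size of this set is an entry of the signless Laplacian, diagonal or not; this avoids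
  separate treatment of degrees and adjacencies.\<close>

definition common_edges :: "'a ugraph \<Rightarrow> 'a \<Rightarrow> 'a \<Rightarrow> 'a set set" where
  "common_edges G x y = {e \<in> edges G. x \<in> e \<and> y \<in> e}"

definition incidence_matrix :: "'a ugraph \<Rightarrow> real mat" where
  "incidence_matrix G = mat (card (verts G)) (card (edges G))
    (\<lambda>(i, j). if from_nat_into (verts G) i \<in> from_nat_into (edges G) j then 1 else 0)"

lemma simple_graph_finite:
  assumes "simple_graph G"
  shows "finite (verts G)" and "finite (edges G)"
proof -
  show V: "finite (verts G)" using assms by (simp add: simple_graph_def)
  have "edges G \<subseteq> Pow (verts G)" using assms by (auto simp: simple_graph_def)
  then show "finite (edges G)" using V finite_subset by blast
qed

text \<open>For equal vertices the common edges are counted by the degree; for distinct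
  \<open>x\<close> and \<open>y\<close> the only candidate is \<open>{x, y}\<close>.\<close>

lemma signless_laplacian_eq_card_common_edges:
  assumes G: "simple_graph G"
  shows "signless_laplacian G = mat (card (verts G)) (card (verts G))
    (\<lambda>(i, j). real (card (common_edges G (from_nat_into (verts G) i) (from_nat_into (verts G) j))))"
proof (rule eq_matI)
  let ?n = "card (verts G)" and ?v = "from_nat_into (verts G)"
  fix i j
  assume "i < dim_row (mat ?n ?n (\<lambda>(i, j). real (card (common_edges G (?v i) (?v j)))))"
    "j < dim_col (mat ?n ?n (\<lambda>(i, j). real (card (common_edges G (?v i) (?v j)))))"
  then have ij: "i < ?n" "j < ?n" by auto
  have inj: "?v i \<noteq> ?v j" if "i \<noteq> j"
    using bij_betw_from_nat_into_finite[OF simple_graph_finite(1)[OF G]] ij that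
    by (auto simp: bij_betw_def inj_on_def)
  \<comment> \<open>A diagonal entry of the adjacency matrix tests the singleton \<open>{x}\<close>,
    so it is 0 and the degree alone remains.\<close>
  have loop: "{x} \<notin> edges G" for x using G by (auto simp: simple_graph_def)
  have common: "common_edges G x y = (if {x, y} \<in> edges G then {{x, y}} else {})" if "x \<noteq> y" for x y
  proof -
    have eq: "e = {x, y}" if "e \<in> edges G" "x \<in> e" "y \<in> e" for e
    proof -
      have "card e = 2" using G that(1) by (simp add: simple_graph_def)
      then have "finite e" using card.infinite by fastforce
      then show ?thesis
        using card_subset_eq[of e "{x, y}"] \<open>card e = 2\<close> that(2,3) \<open>x \<noteq> y\<close> by auto
    qed
    show ?thesis
    proof (cases "{x, y} \<in> edges G")
      case True
      have "{e \<in> edges G. x \<in> e \<and> y \<in> e} = {{x, y}}" using eq True by blast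
      then show ?thesis using True by (simp add: common_edges_def)
    next
      case False
      have "{e \<in> edges G. x \<in> e \<and> y \<in> e} = {}" using eq False by blast
      then show ?thesis using False by (simp add: common_edges_def)
    qed
  qed
  show "signless_laplacian G $$ (i, j)
      = mat ?n ?n (\<lambda>(i, j). real (card (common_edges G (?v i) (?v j)))) $$ (i, j)"
  proof (cases "i = j")
    case True
    then show ?thesis
      using ij loop by (simp add: signless_laplacian_def adjacency_matrix_def degree_matrix_def
          vertex_degree_def common_edges_def)
  next
    case False
    then show ?thesis
      using ij common[OF inj[OF False]]
      by (simp add: signless_laplacian_def adjacency_matrix_def degree_matrix_def)
  qed
qed (simp_all add: signless_laplacian_def adjacency_matrix_def degree_matrix_def)

text \<open>Row \<open>i\<close> is the indicator of the edges at a vertex, so the product of two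
  rows counts common edges.\<close>

lemma incidence_matrix_mult_transpose:
  assumes G: "simple_graph G"
  shows "incidence_matrix G * transpose_mat (incidence_matrix G) = signless_laplacian G"
  unfolding signless_laplacian_eq_card_common_edges[OF G]
proof (rule eq_matI)
  let ?n = "card (verts G)" and ?v = "from_nat_into (verts G)" and ?e = "from_nat_into (edges G)"
  fix i j
  assume "i < dim_row (mat ?n ?n (\<lambda>(i, j). real (card (common_edges G (?v i) (?v j)))))"
    "j < dim_col (mat ?n ?n (\<lambda>(i, j). real (card (common_edges G (?v i) (?v j)))))"
  then have ij: "i < ?n" "j < ?n" by auto
  have "(incidence_matrix G * transpose_mat (incidence_matrix G)) $$ (i, j)
      = (\<Sum>k<card (edges G). (if ?v i \<in> ?e k then 1 else 0) * (if ?v j \<in> ?e k then 1 else 0))"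
    using ij by (simp add: incidence_matrix_def scalar_prod_def lessThan_atLeast0)
  also have "\<dots> = (\<Sum>e\<in>edges G. (if ?v i \<in> e then 1 else 0) * (if ?v j \<in> e then 1 else 0))"
    by (rule sum.reindex_bij_betw[OF bij_betw_from_nat_into_finite[OF simple_graph_finite(2)[OF G]]])
  also have "\<dots> = (\<Sum>e\<in>edges G. if ?v i \<in> e \<and> ?v j \<in> e then 1 else 0)"
    by (rule sum.cong) auto
  also have "\<dots> = real (card (common_edges G (?v i) (?v j)))"
    using simple_graph_finite(2)[OF G] by (simp add: common_edges_def sum.If_cases Int_def)
  finally show "(incidence_matrix G * transpose_mat (incidence_matrix G)) $$ (i, j)
      = mat ?n ?n (\<lambda>(i, j). real (card (common_edges G (?v i) (?v j)))) $$ (i, j)"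
    using ij by simp
qed (simp_all add: incidence_matrix_def)

text \<open>The product of two columns counts shared endpoints: 2 for equal edges, and 1 or 0 for
  distinct edges according to adjacency in the line graph.\<close>

lemma transpose_mult_incidence_matrix:
  assumes G: "simple_graph G"
  shows "transpose_mat (incidence_matrix G) * incidence_matrix G
    = adjacency_matrix (line_graph G) + 2 \<cdot>\<^sub>m 1\<^sub>m (card (edges G))"
proof (rule eq_matI)
  let ?m = "card (edges G)" and ?v = "from_nat_into (verts G)" and ?e = "from_nat_into (edges G)"
  fix i j
  assume "i < dim_row (adjacency_matrix (line_graph G) + 2 \<cdot>\<^sub>m 1\<^sub>m ?m)"
    "j < dim_col (adjacency_matrix (line_graph G) + 2 \<cdot>\<^sub>m 1\<^sub>m ?m)"
  then have ij: "i < ?m" "j < ?m" by auto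
  have bij: "bij_betw ?e {..<?m} (edges G)"
    by (rule bij_betw_from_nat_into_finite[OF simple_graph_finite(2)[OF G]])
  then have eE: "?e i \<in> edges G" "?e j \<in> edges G" using ij by (auto simp: bij_betw_def)
  have inj: "?e i = ?e j \<longleftrightarrow> i = j" using bij ij by (auto simp: bij_betw_def inj_on_def)
  have c2: "card e = 2" "finite e" "e \<subseteq> verts G" if "e \<in> edges G" for e
    using G that finite_subset unfolding simple_graph_def by auto
  have "(transpose_mat (incidence_matrix G) * incidence_matrix G) $$ (i, j)
      = (\<Sum>k<card (verts G). (if ?v k \<in> ?e i then 1 else 0) * (if ?v k \<in> ?e j then 1 else 0))"
    using ij by (simp add: incidence_matrix_def scalar_prod_def lessThan_atLeast0)
  also have "\<dots> = (\<Sum>x\<in>verts G. (if x \<in> ?e i then 1 else 0) * (if x \<in> ?e j then 1 else 0))"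
    by (rule sum.reindex_bij_betw[OF bij_betw_from_nat_into_finite[OF simple_graph_finite(1)[OF G]]])
  also have "\<dots> = (\<Sum>x\<in>verts G. if x \<in> ?e i \<inter> ?e j then 1 else 0)"
    by (rule sum.cong) auto
  also have "\<dots> = real (card (verts G \<inter> (?e i \<inter> ?e j)))"
    using simple_graph_finite(1)[OF G] by (simp add: sum.If_cases Int_def)
  also have "verts G \<inter> (?e i \<inter> ?e j) = ?e i \<inter> ?e j" using c2(3)[OF eE(1)] by auto
  also have "real (card (?e i \<inter> ?e j)) = (adjacency_matrix (line_graph G) + 2 \<cdot>\<^sub>m 1\<^sub>m ?m) $$ (i, j)"
  proof -
    have edge: "{?e i, ?e j} \<in> edges (line_graph G) \<longleftrightarrow> i \<noteq> j \<and> ?e i \<inter> ?e j \<noteq> {}"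
      unfolding inj[symmetric] using eE by (auto simp: line_graph_def doubleton_eq_iff)
    have rhs: "(adjacency_matrix (line_graph G) + 2 \<cdot>\<^sub>m 1\<^sub>m ?m) $$ (i, j)
        = (if i \<noteq> j \<and> ?e i \<inter> ?e j \<noteq> {} then 1 else 0) + (if i = j then 2 else 0)"
      using ij edge by (simp add: adjacency_matrix_def line_graph_def)
    show ?thesis
    proof (cases "i = j")
      case True
      then show ?thesis using c2(1)[OF eE(1)] rhs by simp
    next
      case False
      then have "?e i \<noteq> ?e j" using inj by simp
      \<comment> \<open>Distinct sets of size 2 do not contain one another, so they share at most
        one element.\<close>
      then have "?e i \<inter> ?e j \<noteq> ?e i"
        using card_subset_eq[OF c2(2)[OF eE(2)], of "?e i"] c2(1)[OF eE(1)] c2(1)[OF eE(2)] by auto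
      then have "?e i \<inter> ?e j \<subset> ?e i" by blast
      then have "card (?e i \<inter> ?e j) < 2" using psubset_card_mono c2 eE(1) by metis
      moreover have "card (?e i \<inter> ?e j) = 0 \<longleftrightarrow> ?e i \<inter> ?e j = {}" using c2(2)[OF eE(1)] by simp
      ultimately have "card (?e i \<inter> ?e j) = (if ?e i \<inter> ?e j = {} then 0 else 1)" by auto
      then show ?thesis using rhs False by simp
    qed
  qed
  finally show "(transpose_mat (incidence_matrix G) * incidence_matrix G) $$ (i, j)
      = (adjacency_matrix (line_graph G) + 2 \<cdot>\<^sub>m 1\<^sub>m ?m) $$ (i, j)" .
qed (simp_all add: incidence_matrix_def adjacency_matrix_def line_graph_def)

section \<open>Shifted signless Laplacians and the signature of a line graph\<close>

abbreviation shifted_laplacian :: "'a ugraph \<Rightarrow> real mat" where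
  "shifted_laplacian G \<equiv> signless_laplacian G - 2 \<cdot>\<^sub>m 1\<^sub>m (card (verts G))"

lemma signless_laplacian_carrier [simp]:
  "signless_laplacian G \<in> carrier_mat (card (verts G)) (card (verts G))"
  by (simp add: signless_laplacian_def adjacency_matrix_def degree_matrix_def)

lemma shifted_laplacian_carrier [simp]:
  "shifted_laplacian G \<in> carrier_mat (card (verts G)) (card (verts G))"
  by (rule minus_carrier_mat) simp

lemma shifted_laplacian_sym:
  "transpose_mat (shifted_laplacian G) = shifted_laplacian G"
  by (rule eq_matI)
    (auto simp: signless_laplacian_def adjacency_matrix_def degree_matrix_def insert_commute)

lemma eigenvalue_shifted_laplacian:
  "eigenvalue (shifted_laplacian G) 0 \<longleftrightarrow> eigenvalue (signless_laplacian G) 2"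
proof -
  have "char_matrix (shifted_laplacian G) 0 = char_matrix (signless_laplacian G) 2"
    by (rule eq_matI) (auto simp: char_matrix_def signless_laplacian_def adjacency_matrix_def
        degree_matrix_def)
  then show ?thesis
    using eigenvalue_det[of "shifted_laplacian G" "card (verts G)"]
      eigenvalue_det[of "signless_laplacian G" "card (verts G)"]
    by simp
qed

definition signature :: "real mat \<Rightarrow> int" where
  "signature A = int (eigenvalue_count (\<lambda>x. x > 0) A) - int (eigenvalue_count (\<lambda>x. x < 0) A)"

lemma graph_signature_eq: "graph_signature G = signature (adjacency_matrix G)"
  by (simp add: graph_signature_def signature_def eigenvalue_count_def pos_eigenvalue_count_def
      neg_eigenvalue_count_def)

text \<open>In the Schur complement identity the scalar blocks \<open>?A\<close> and
  \<open>?D\<close> have no positive eigenvalues, and as many negative ones as there are edges and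
  vertices, respectively. So the positive counts of the complements agree, and the negative ones
  differ by the number of edges minus the number of vertices.\<close>

lemma graph_signature_line_graph:
  assumes G: "simple_graph G"
  shows "graph_signature (line_graph G)
    = signature (shifted_laplacian G) + int (card (verts G)) - int (card (edges G))"
proof -
  let ?n = "card (verts G)" and ?m = "card (edges G)"
  let ?N = "incidence_matrix G"
  let ?NT = "transpose_mat ?N"
  \<comment> \<open>Chosen so that the two Schur complements are exactly \<open>Q(G) - 2 I\<close> and \<open>A(L(G))\<close>.\<close>
  define a where "a = 1 / sqrt 2"
  have a: "a * a = 1 / 2" by (simp add: a_def)
  let ?A = "(-2) \<cdot>\<^sub>m 1\<^sub>m ?m :: real mat" and ?D = "(-2) \<cdot>\<^sub>m 1\<^sub>m ?n :: real mat"
  let ?X = "a \<cdot>\<^sub>m ?NT" and ?Y = "a \<cdot>\<^sub>m ?N"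
  have N: "?N \<in> carrier_mat ?n ?m" by (simp add: incidence_matrix_def)
  have NT: "?NT \<in> carrier_mat ?m ?n" using N by simp
  have AX: "?A * ?X = (-2 * a) \<cdot>\<^sub>m ?NT"
    using NT by (intro eq_matI) (auto simp: mult_smult_assoc_mat[of _ ?m ?m _ ?n])
  have DY: "?D * ?Y = (-2 * a) \<cdot>\<^sub>m ?N"
    using N by (intro eq_matI) (auto simp: mult_smult_assoc_mat[of _ ?n ?n _ ?m])
  have scale: "(-2 * a) \<cdot>\<^sub>m P * (a \<cdot>\<^sub>m R) = - (P * R)"
    if "P \<in> carrier_mat p q" "R \<in> carrier_mat q r" for P R :: "real mat" and p q r
  proof -
    have "(-2 * a) \<cdot>\<^sub>m P * (a \<cdot>\<^sub>m R) = (-2 * (a * a)) \<cdot>\<^sub>m (P * R)"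
      using that by (intro eq_matI) (auto simp: mult_smult_assoc_mat[of _ p q _ r] mult_smult_distrib[of _ p q _ r])
    also have "\<dots> = - (P * R)" by (rule eq_matI) (auto simp: a)
    finally show ?thesis .
  qed
  have 1: "?D - ?D * ?Y * ?X = shifted_laplacian G"
    unfolding DY scale[OF N NT] incidence_matrix_mult_transpose[OF G]
    by (rule eq_matI) (auto simp: signless_laplacian_def adjacency_matrix_def degree_matrix_def)
  have 2: "?A - ?A * ?X * ?Y = adjacency_matrix (line_graph G)"
    unfolding AX scale[OF NT N] transpose_mult_incidence_matrix[OF G]
    by (rule eq_matI) (auto simp: adjacency_matrix_def line_graph_def)
  have sym: "transpose_mat ?A = ?A" "transpose_mat ?D = ?D" by (auto intro!: eq_matI)
  have "?A * ?X = transpose_mat (?D * ?Y)"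
    unfolding AX DY by (rule eq_matI) (use N in auto)
  then have *: "eigenvalue_count (\<lambda>x. s * x > 0) ?A + eigenvalue_count (\<lambda>x. s * x > 0) (shifted_laplacian G)
      = eigenvalue_count (\<lambda>x. s * x > 0) (adjacency_matrix (line_graph G))
        + eigenvalue_count (\<lambda>x. s * x > 0) ?D" if "s = 1 \<or> s = -1" for s
    using eigenvalue_count_schur_complements[OF that _ sym(1) _ sym(2), of ?m ?n ?X ?Y] N 1 2 by simp
  show ?thesis
    using *[of 1] *[of "-1"] by (simp add: graph_signature_eq signature_def eigenvalue_count_smult_one)
qed

section \<open>Joining two graphs by an edge\<close>

text \<open>The matrices \<open>B\<close> and \<open>B + w w\<^sup>T\<close> arise by eliminating in the bordered matrix with diagonal
  blocks \<open>B\<close>, \<open>-1\<close> and off-diagonal block \<open>w\<close>; the other complement is the scalar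
  \<open>-1 - w\<^sup>T P w < 0\<close>.\<close>

lemma eigenvalue_count_rank_one_update:
  fixes B P w :: "real mat"
  assumes B: "B \<in> carrier_mat n n" "transpose_mat B = B"
    and P: "P \<in> carrier_mat n n" "B * P = 1\<^sub>m n"
    and w: "w \<in> carrier_mat n 1"
    and pos: "(transpose_mat w * (P * w)) $$ (0, 0) > -1"
    and s: "s = 1 \<or> s = -1"
  shows "eigenvalue_count (\<lambda>x. s * x > 0) (B + w * transpose_mat w)
    = eigenvalue_count (\<lambda>x. s * x > 0) B"
proof -
  let ?D = "(-1) \<cdot>\<^sub>m 1\<^sub>m 1 :: real mat"
  let ?Y = "- transpose_mat w"
  let ?c = "- 1 - (transpose_mat w * (P * w)) $$ (0, 0)"
  have wT: "transpose_mat w \<in> carrier_mat 1 n" using w by simp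
  have DY: "?D * ?Y = transpose_mat w"
    using wT by (intro eq_matI) (auto simp: mult_smult_assoc_mat[of _ 1 1 _ n])
  \<comment> \<open>\<open>P * w\<close> is the solution of \<open>B * X = w\<close>, as required to
    eliminate the border \<open>w\<close> with \<open>B\<close> as pivot.\<close>
  have BX: "B * (P * w) = w"
    using assoc_mult_mat[OF B(1) P(1) w] P(2) left_mult_one_mat[OF w] by simp
  have X: "P * w \<in> carrier_mat n 1" using P w by simp
  have 1: "?D - ?D * ?Y * (P * w) = ?c \<cdot>\<^sub>m 1\<^sub>m 1"
    unfolding DY using wT X by (intro eq_matI) auto
  have 2: "B - B * (P * w) * ?Y = B + w * transpose_mat w"
    unfolding BX using B w by (intro eq_matI) auto
  have sym: "transpose_mat ?D = ?D" by (auto intro!: eq_matI)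
  have "B * (P * w) = transpose_mat (?D * ?Y)" unfolding BX DY by simp
  then have "eigenvalue_count (\<lambda>x. s * x > 0) B + eigenvalue_count (\<lambda>x. s * x > 0) (?c \<cdot>\<^sub>m 1\<^sub>m 1)
      = eigenvalue_count (\<lambda>x. s * x > 0) (B + w * transpose_mat w)
        + eigenvalue_count (\<lambda>x. s * x > 0) ?D"
    using eigenvalue_count_schur_complements[OF s B _ sym X, of ?Y] wT 1 2 by simp
  \<comment> \<open>By \<open>pos\<close> the scalar \<open>?c\<close> is negative, like -1, so the
    two 1 by 1 terms cancel.\<close>
  moreover have "eigenvalue_count (\<lambda>x. s * x > 0) (?c \<cdot>\<^sub>m 1\<^sub>m 1) = eigenvalue_count (\<lambda>x. s * x > 0) ?D"
    unfolding eigenvalue_count_smult_one using s pos by auto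
  ultimately show ?thesis by simp
qed

text \<open>The determinant is nonzero because 0 is not an eigenvalue after the shift. Hence
  \<open>the\<close> in the definition of \<open>phi\<close> is applied to an actual
  inverse.\<close>

lemma shifted_laplacian_mat_inverse:
  assumes "\<not> eigenvalue (signless_laplacian G) 2"
  obtains P where "mat_inverse (shifted_laplacian G) = Some P"
    "P \<in> carrier_mat (card (verts G)) (card (verts G))"
    "shifted_laplacian G * P = 1\<^sub>m (card (verts G))"
proof -
  let ?n = "card (verts G)"
  have M: "shifted_laplacian G \<in> carrier_mat ?n ?n" by simp
  have "char_matrix (shifted_laplacian G) 0 = shifted_laplacian G"
    by (rule eq_matI) (auto simp: char_matrix_def)
  then have "det (shifted_laplacian G) \<noteq> 0"
    using assms eigenvalue_det[OF M, of 0] unfolding eigenvalue_shifted_laplacian by simp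
  then have "mat_inverse (shifted_laplacian G) \<noteq> None"
    using mat_inverse(1)[OF M, where b = "()"] det_non_zero_imp_unit[OF M, where b = "()"] by blast
  then obtain P where "mat_inverse (shifted_laplacian G) = Some P" by blast
  then show thesis using that mat_inverse(2)[OF M] by blast
qed

text \<open>With the vertices of \<open>G1\<close> listed before those of \<open>G2\<close>, the new
  edge adds \<open>w * transpose_mat w\<close> to a block diagonal matrix. The quantity that
  controls this rank one update is the sum of the two \<open>phi\<close> values.\<close>

lemma eigenvalue_count_shifted_laplacian_add_edge:
  fixes G1 G2 :: "'a ugraph"
  assumes G1: "simple_graph G1" and G2: "simple_graph G2"
    and disj: "verts G1 \<inter> verts G2 = {}"
    and e1: "\<not> eigenvalue (signless_laplacian G1) 2" and e2: "\<not> eigenvalue (signless_laplacian G2) 2"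
    and u: "u \<in> verts G1" and v: "v \<in> verts G2"
    and phi: "phi G1 u + phi G2 v > -1"
    and G: "G = add_edge (graph_union G1 G2) u v"
    and s: "s = 1 \<or> s = -1"
  shows "eigenvalue_count (\<lambda>x. s * x > 0) (shifted_laplacian G)
    = eigenvalue_count (\<lambda>x. s * x > 0) (shifted_laplacian G1)
      + eigenvalue_count (\<lambda>x. s * x > 0) (shifted_laplacian G2)"
proof -
  let ?n1 = "card (verts G1)" and ?n2 = "card (verts G2)"
  note fin1 = simple_graph_finite[OF G1] and fin2 = simple_graph_finite[OF G2]
  have V: "verts G = verts G1 \<union> verts G2" and E: "edges G = insert {u, v} (edges G1 \<union> edges G2)"
    by (auto simp: G add_edge_def graph_union_def)
  have sub: "x \<in> verts G1" if "e \<in> edges G1" "x \<in> e" for e x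
    using G1 that by (auto simp: simple_graph_def)
  have sub2: "x \<in> verts G2" if "e \<in> edges G2" "x \<in> e" for e x
    using G2 that by (auto simp: simple_graph_def)
  have uv: "u \<notin> verts G2" "v \<notin> verts G1" "u \<noteq> v" using u v disj by auto
  have new: "{u, v} \<notin> edges G1" "{u, v} \<notin> edges G2" using sub sub2 uv by blast+
  have simple: "simple_graph G"
    using G1 G2 u v uv by (auto simp: simple_graph_def V E)
  have n: "card (verts G) = ?n1 + ?n2" using fin1 fin2 disj by (simp add: V card_Un_disjoint)
  define h where "h i = (if i < ?n1 then from_nat_into (verts G1) i
    else from_nat_into (verts G2) (i - ?n1))" for i
  \<comment> \<open>\<open>f\<close> gives the matrix entry for a pair of vertices rather than
    indices, so that it serves both for the standard enumeration and for \<open>h\<close>.\<close>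
  define f where "f x y = real (card (common_edges G x y)) - (if x = y then 2 else 0)" for x y
  have b1: "bij_betw (from_nat_into (verts G1)) {..<?n1} (verts G1)"
    and b2: "bij_betw (from_nat_into (verts G2)) {..<?n2} (verts G2)"
    using bij_betw_from_nat_into_finite fin1 fin2 by blast+
  have h1: "h i = from_nat_into (verts G1) i" if "i < ?n1" for i using that by (simp add: h_def)
  have h2: "h (?n1 + i) = from_nat_into (verts G2) i" for i by (simp add: h_def)
  have in1: "from_nat_into (verts G1) i \<in> verts G1" if "i < ?n1" for i
    using b1 that by (auto simp: bij_betw_def)
  have in2: "from_nat_into (verts G2) i \<in> verts G2" if "i < ?n2" for i
    using b2 that by (auto simp: bij_betw_def)
  have bh: "bij_betw h {..<?n1 + ?n2} (verts G)"
  proof -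
    have "bij_betw h {..<?n1} (verts G1)" using b1 h1 by (subst bij_betw_cong[of _ h "from_nat_into (verts G1)"]) auto
    moreover have "bij_betw h ((+) ?n1 ` {..<?n2}) (verts G2)"
    proof (rule bij_betw_imageI)
      show "inj_on h ((+) ?n1 ` {..<?n2})"
        using b2 by (auto simp: bij_betw_def inj_on_def h2)
      show "h ` (+) ?n1 ` {..<?n2} = verts G2"
        using b2 by (simp add: bij_betw_def image_image h2)
    qed
    moreover have "{..<?n1 + ?n2} = {..<?n1} \<union> (+) ?n1 ` {..<?n2}"
    proof (intro equalityI subsetI)
      fix i assume "i \<in> {..<?n1 + ?n2}"
      then show "i \<in> {..<?n1} \<union> (+) ?n1 ` {..<?n2}"
        by (cases "i < ?n1") (auto intro!: image_eqI[of _ _ "i - ?n1"])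
    qed auto
    ultimately show ?thesis using bij_betw_combine[OF _ _ disj] by (simp add: V)
  qed
  have bG: "bij_betw (from_nat_into (verts G)) {..<?n1 + ?n2} (verts G)"
    using bij_betw_from_nat_into_finite[OF simple_graph_finite(1)[OF simple]] n by simp
  have fsym: "f x y = f y x" for x y
    by (auto simp: f_def common_edges_def intro!: arg_cong[where f = card])
  have shifted: "shifted_laplacian H = mat (card (verts H)) (card (verts H)) (\<lambda>(i, j).
      real (card (common_edges H (from_nat_into (verts H) i) (from_nat_into (verts H) j)))
      - (if i = j then 2 else 0))" if "simple_graph H" for H :: "'a ugraph"
    unfolding signless_laplacian_eq_card_common_edges[OF that] by (rule eq_matI) auto
  have MG: "shifted_laplacian G = mat (?n1 + ?n2) (?n1 + ?n2)
      (\<lambda>(i, j). f (from_nat_into (verts G) i) (from_nat_into (verts G) j))"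
    unfolding shifted[OF simple] unfolding n
    using bG by (intro eq_matI) (auto simp: f_def bij_betw_def inj_on_def)
  \<comment> \<open>The last term is the new edge. It covers equal and distinct ends alike, that is,
    the growth of both degrees and the new adjacency.\<close>
  have card_common: "real (card (common_edges G x y)) = real (card (common_edges G1 x y))
      + real (card (common_edges G2 x y)) + (if x \<in> {u, v} \<and> y \<in> {u, v} then 1 else 0)" for x y
  proof -
    have "common_edges G x y = common_edges G1 x y \<union> common_edges G2 x y
        \<union> (if x \<in> {u, v} \<and> y \<in> {u, v} then {{u, v}} else {})"
      by (auto simp: common_edges_def E)
    moreover have "common_edges G1 x y \<inter> common_edges G2 x y = {}"
      using sub sub2 disj by (fastforce simp: common_edges_def)
    moreover have "finite (common_edges G1 x y)" "finite (common_edges G2 x y)"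
      using fin1 fin2 by (simp_all add: common_edges_def)
    moreover have "{u, v} \<notin> common_edges G1 x y \<union> common_edges G2 x y"
      using new by (simp add: common_edges_def)
    ultimately show ?thesis by (simp add: card_Un_disjoint)
  qed
  have common1: "common_edges G1 x y = {}" if "x \<in> verts G2 \<or> y \<in> verts G2" for x y
    using that sub disj by (auto simp: common_edges_def)
  have common2: "common_edges G2 x y = {}" if "x \<in> verts G1 \<or> y \<in> verts G1" for x y
    using that sub2 disj by (auto simp: common_edges_def)
  \<comment> \<open>\<open>a\<close> and \<open>b\<close> are the indices at which
    \<open>phi\<close> reads the inverses; in the order \<open>h\<close> the vertex \<open>v\<close>
    has index \<open>?n1 + b\<close>.\<close>
  define a where "a = to_nat_on (verts G1) u"
  define b where "b = to_nat_on (verts G2) v"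
  have a: "a < ?n1" "from_nat_into (verts G1) a = u" and b: "b < ?n2" "from_nat_into (verts G2) b = v"
    using to_nat_on_finite[OF fin1(1)] to_nat_on_finite[OF fin2(1)] u v fin1 fin2
    by (auto simp: a_def b_def bij_betw_def countable_finite)
  have iu: "from_nat_into (verts G1) i = u \<longleftrightarrow> i = a" if "i < ?n1" for i
    using b1 a that by (auto simp: bij_betw_def inj_on_def)
  have iv: "from_nat_into (verts G2) i = v \<longleftrightarrow> i = b" if "i < ?n2" for i
    using b2 b that by (auto simp: bij_betw_def inj_on_def)
  define w where "w = mat (?n1 + ?n2) 1 (\<lambda>(i, _). if i = a \<or> i = ?n1 + b then 1 else 0 :: real)"
  have w: "w \<in> carrier_mat (?n1 + ?n2) 1" by (simp add: w_def)
  let ?M1 = "shifted_laplacian G1" and ?M2 = "shifted_laplacian G2"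
  have M: "?M1 \<in> carrier_mat ?n1 ?n1" "?M2 \<in> carrier_mat ?n2 ?n2" by simp_all
  define B where "B = four_block_mat ?M1 (0\<^sub>m ?n1 ?n2) (0\<^sub>m ?n2 ?n1) ?M2"
  have B: "B \<in> carrier_mat (?n1 + ?n2) (?n1 + ?n2)" by (simp add: B_def)
  have Bsym: "transpose_mat B = B"
    unfolding B_def transpose_four_block_mat[OF M(1) zero_carrier_mat zero_carrier_mat M(2)]
    by (simp add: shifted_laplacian_sym)
  have f11: "f x y = real (card (common_edges G1 x y)) - (if x = y then 2 else 0)
      + (if x = u \<and> y = u then 1 else 0)" if "x \<in> verts G1" "y \<in> verts G1" for x y
    using that uv by (auto simp: f_def card_common common2)
  have f22: "f x y = real (card (common_edges G2 x y)) - (if x = y then 2 else 0)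
      + (if x = v \<and> y = v then 1 else 0)" if "x \<in> verts G2" "y \<in> verts G2" for x y
    using that uv by (auto simp: f_def card_common common1)
  have f12: "f x y = (if x = u \<and> y = v then 1 else 0)" if "x \<in> verts G1" "y \<in> verts G2" for x y
    using that uv disj by (auto simp: f_def card_common common1 common2)
  have i1: "from_nat_into (verts G1) i = from_nat_into (verts G1) j \<longleftrightarrow> i = j"
    if "i < ?n1" "j < ?n1" for i j using b1 that by (auto simp: bij_betw_def inj_on_def)
  have i2: "from_nat_into (verts G2) i = from_nat_into (verts G2) j \<longleftrightarrow> i = j"
    if "i < ?n2" "j < ?n2" for i j using b2 that by (auto simp: bij_betw_def inj_on_def)
  \<comment> \<open>Compared block by block: \<open>w * transpose_mat w\<close> has its four ones at
    the rows and columns of \<open>u\<close> and \<open>v\<close>, one in each block.\<close>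
  have Mh: "mat (?n1 + ?n2) (?n1 + ?n2) (\<lambda>(i, j). f (h i) (h j)) = B + w * transpose_mat w"
  proof (rule eq_matI)
    fix i j assume "i < dim_row (B + w * transpose_mat w)" "j < dim_col (B + w * transpose_mat w)"
    then have ij: "i < ?n1 + ?n2" "j < ?n1 + ?n2" by (auto simp: w_def)
    have ww: "(w * transpose_mat w) $$ (k, l)
        = (if (k = a \<or> k = ?n1 + b) \<and> (l = a \<or> l = ?n1 + b) then 1 else 0)"
      if "k < ?n1 + ?n2" "l < ?n1 + ?n2" for k l
      using that by (simp add: w_def scalar_prod_def)
    have split: "k < ?n1 \<or> (\<exists>l<?n2. k = ?n1 + l)" if "k < ?n1 + ?n2" for k
      using that by (metis add_less_cancel_left le_add_diff_inverse not_less)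
    have "f (h i) (h j) = B $$ (i, j) + (w * transpose_mat w) $$ (i, j)"
      using split[OF ij(1)] split[OF ij(2)]
    proof (elim disjE exE conjE)
      assume "i < ?n1" "j < ?n1"
      then show ?thesis using a(1)
        by (simp add: ww B_def h1 in1 f11 shifted[OF G1] i1 iu)
    next
      fix l assume "i < ?n1" "l < ?n2" "j = ?n1 + l"
      then show ?thesis using a(1) M
        by (simp add: ww B_def h1 h2 in1 in2 f12 iu iv)
    next
      fix l assume "j < ?n1" "l < ?n2" "i = ?n1 + l"
      then show ?thesis using a(1) M fsym[of "h i" "h j"]
        by (simp add: ww B_def h1 h2 in1 in2 f12 iu iv)
    next
      fix k l assume "l < ?n2" "i = ?n1 + l" "k < ?n2" "j = ?n1 + k"
      then show ?thesis using a(1) M(1)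
        by (simp add: ww B_def h2 in2 f22 shifted[OF G2] i2 iv)
    qed
    then show "mat (?n1 + ?n2) (?n1 + ?n2) (\<lambda>(i, j). f (h i) (h j)) $$ (i, j)
        = (B + w * transpose_mat w) $$ (i, j)"
      using ij w by simp
  qed (simp_all add: w_def)
  obtain P1 where P1: "mat_inverse ?M1 = Some P1" "P1 \<in> carrier_mat ?n1 ?n1" "?M1 * P1 = 1\<^sub>m ?n1"
    using shifted_laplacian_mat_inverse[OF e1] by blast
  obtain P2 where P2: "mat_inverse ?M2 = Some P2" "P2 \<in> carrier_mat ?n2 ?n2" "?M2 * P2 = 1\<^sub>m ?n2"
    using shifted_laplacian_mat_inverse[OF e2] by blast
  define P where "P = four_block_mat P1 (0\<^sub>m ?n1 ?n2) (0\<^sub>m ?n2 ?n1) P2"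
  have P: "P \<in> carrier_mat (?n1 + ?n2) (?n1 + ?n2)" using P1 P2 by (simp add: P_def)
  have BP: "B * P = 1\<^sub>m (?n1 + ?n2)"
    unfolding B_def P_def
    using mult_four_block_mat[OF M(1) zero_carrier_mat zero_carrier_mat M(2)
        P1(2) zero_carrier_mat zero_carrier_mat P2(2)] P1 P2 M
    by simp
  have ab: "a \<noteq> ?n1 + b" "a < ?n1 + ?n2" "?n1 + b < ?n1 + ?n2" using a b by auto
  have sum_w: "(\<Sum>l<?n1 + ?n2. g l * w $$ (l, 0)) = g a + g (?n1 + b)" for g :: "nat \<Rightarrow> real"
  proof -
    have "(\<Sum>l<?n1 + ?n2. g l * w $$ (l, 0))
        = (\<Sum>l<?n1 + ?n2. (if l = a then g l else 0) + (if l = ?n1 + b then g l else 0))"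
      by (rule sum.cong) (use ab in \<open>auto simp: w_def\<close>)
    then show ?thesis using ab by (simp add: sum.distrib)
  qed
  have Pw: "(P * w) $$ (k, 0) = P $$ (k, a) + P $$ (k, ?n1 + b)" if "k < ?n1 + ?n2" for k
  proof -
    have "(P * w) $$ (k, 0) = (\<Sum>l<?n1 + ?n2. P $$ (k, l) * w $$ (l, 0))"
      using that P w by (simp add: scalar_prod_def lessThan_atLeast0)
    then show ?thesis by (simp add: sum_w)
  qed
  have "(transpose_mat w * (P * w)) $$ (0, 0) = (\<Sum>l<?n1 + ?n2. (P * w) $$ (l, 0) * w $$ (l, 0))"
  proof -
    have "(transpose_mat w * Q) $$ (0, 0) = (\<Sum>l<?n1 + ?n2. Q $$ (l, 0) * w $$ (l, 0))"
      if "Q \<in> carrier_mat (?n1 + ?n2) 1" for Q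
      using that w by (simp add: scalar_prod_def lessThan_atLeast0 mult.commute)
    from this[OF mult_carrier_mat[OF P w]] show ?thesis .
  qed
  also have "\<dots> = P $$ (a, a) + P $$ (a, ?n1 + b) + (P $$ (?n1 + b, a) + P $$ (?n1 + b, ?n1 + b))"
    unfolding sum_w using Pw ab by simp
  \<comment> \<open>The two mixed entries lie in the zero blocks of \<open>P\<close>.\<close>
  also have "\<dots> = P1 $$ (a, a) + P2 $$ (b, b)"
    using P1(2) P2(2) a b by (simp add: P_def)
  also have "\<dots> = phi G1 u + phi G2 v" by (simp add: phi_def P1(1) P2(1) a_def b_def)
  finally have "(transpose_mat w * (P * w)) $$ (0, 0) > -1" using phi by simp
  then have "eigenvalue_count (\<lambda>x. s * x > 0) (B + w * transpose_mat w)
      = eigenvalue_count (\<lambda>x. s * x > 0) B"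
    by (rule eigenvalue_count_rank_one_update[OF B Bsym P BP w _ s])
  also have "\<dots> = eigenvalue_count (\<lambda>x. s * x > 0) ?M1 + eigenvalue_count (\<lambda>x. s * x > 0) ?M2"
    unfolding B_def by (rule eigenvalue_count_four_block_diag) (simp_all add: shifted_laplacian_sym)
  \<comment> \<open>The order \<open>h\<close> is exchanged for the standard enumeration of
    \<open>verts G\<close>.\<close>
  finally show ?thesis
    unfolding MG Mh[symmetric] using eigenvalue_count_reindex[where f = f, OF s fsym bG bh] by simp
qed

theorem lemma4:
  fixes G1 G2 G :: "'a ugraph" and u v :: 'a
  assumes "simple_graph G1" and "simple_graph G2"
    and "verts G1 \<inter> verts G2 = {}"
    and "card (edges G1) \<ge> card (verts G1)"
    and "card (edges G2) \<ge> card (verts G2)"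
    and "\<not> eigenvalue (signless_laplacian G1) 2"
    and "\<not> eigenvalue (signless_laplacian G2) 2"
    and "u \<in> verts G1" and "v \<in> verts G2"
    and "phi G1 u + phi G2 v > -1"
    and "G = add_edge (graph_union G1 G2) u v"
  shows "graph_signature (line_graph G) =
           graph_signature (line_graph G1) + graph_signature (line_graph G2) - 1
         \<and> \<not> eigenvalue (signless_laplacian G) 2"
proof -
  note fin = simple_graph_finite[OF assms(1)] simple_graph_finite[OF assms(2)]
  have "u \<noteq> v" using assms(3,8,9) by blast
  then have simple: "simple_graph G"
    using assms(1-3,8,9) by (auto simp: simple_graph_def assms(11) add_edge_def graph_union_def)
  have n: "card (verts G) = card (verts G1) + card (verts G2)"
    using fin assms(3) by (simp add: assms(11) add_edge_def graph_union_def card_Un_disjoint)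
  have ne: "e \<noteq> {}" if "e \<in> edges G1 \<union> edges G2" for e
    using that assms(1,2) by (auto simp: simple_graph_def)
  have sub: "e \<subseteq> verts G1" if "e \<in> edges G1" for e using that assms(1) by (auto simp: simple_graph_def)
  have sub2: "e \<subseteq> verts G2" if "e \<in> edges G2" for e using that assms(2) by (auto simp: simple_graph_def)
  have "edges G1 \<inter> edges G2 = {}"
  proof (rule equals0I)
    fix e assume "e \<in> edges G1 \<inter> edges G2"
    then have "e \<subseteq> verts G1 \<inter> verts G2" "e \<noteq> {}" using sub sub2 ne by auto
    then show False using assms(3) by simp
  qed
  moreover have "{u, v} \<notin> edges G1 \<union> edges G2" using sub sub2 assms(3,8,9) by blast
  \<comment> \<open>The successor stands for the edge \<open>{u, v}\<close>; it is the source of the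
    -1 in the signature formula.\<close>
  ultimately have m: "card (edges G) = Suc (card (edges G1) + card (edges G2))"
    using fin by (simp add: assms(11) add_edge_def graph_union_def card_Un_disjoint)
  note counts = eigenvalue_count_shifted_laplacian_add_edge[OF assms(1-3,6-11)]
  have pos: "eigenvalue_count (\<lambda>x. x > 0) (shifted_laplacian G)
      = eigenvalue_count (\<lambda>x. x > 0) (shifted_laplacian G1)
        + eigenvalue_count (\<lambda>x. x > 0) (shifted_laplacian G2)"
    using counts[of 1] by simp
  have neg: "eigenvalue_count (\<lambda>x. x < 0) (shifted_laplacian G)
      = eigenvalue_count (\<lambda>x. x < 0) (shifted_laplacian G1)
        + eigenvalue_count (\<lambda>x. x < 0) (shifted_laplacian G2)"
    using counts[of "-1"] by simp
  have nonsing: "eigenvalue_count (\<lambda>x. x > 0) (shifted_laplacian H)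
      + eigenvalue_count (\<lambda>x. x < 0) (shifted_laplacian H) = card (verts H)
      \<longleftrightarrow> \<not> eigenvalue (signless_laplacian H) 2" for H :: "'a ugraph"
    unfolding eigenvalue_shifted_laplacian[symmetric]
    by (rule eigenvalue_count_pos_neg_eq_dim_iff) (simp_all add: shifted_laplacian_sym)
  \<comment> \<open>The counts of \<open>G1\<close> and \<open>G2\<close> exhaust their dimensions,
    so by additivity those of \<open>G\<close> exhaust the sum, which is the number of vertices of
    \<open>G\<close>.\<close>
  have "\<not> eigenvalue (signless_laplacian G) 2"
    using nonsing[of G] nonsing[of G1] nonsing[of G2] assms(6,7) pos neg n by simp
  moreover have sig: "signature (shifted_laplacian G)
      = signature (shifted_laplacian G1) + signature (shifted_laplacian G2)"
    by (simp add: signature_def pos neg)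
  have "graph_signature (line_graph G)
      = graph_signature (line_graph G1) + graph_signature (line_graph G2) - 1"
    unfolding graph_signature_line_graph[OF simple] graph_signature_line_graph[OF assms(1)]
      graph_signature_line_graph[OF assms(2)] sig
    unfolding n m by simp
  ultimately show ?thesis by blast
qed

end
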